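(* Let $K$ be a field, $\mathcal G$ an ample groupoid, and $(E,p)$ a simple $\mathcal G$-sheaf of $K$-vector spaces. Let $X=\overline{\mathrm{supp}(E)}$, which is a closed invariant subspace of $\mathcal G^0$. (1) If $u\in\mathrm{supp}(E)$, then $\overline{\mathcal O_u}=X$. (2) $K\mathcal G|_{\mathcal G^0\setminus X}\subseteq\mathrm{ann}(\Gamma_c(E))$, and $\Gamma_c(E)$ is a simple $K\mathcal G|_X$-module with the $K\mathcal G$-action factoring through the quotient map $K\mathcal G\to K\mathcal G|_X$.
   Context: A topological groupoid $\mathcal G$ (arrow space $\mathcal G^1$, unit space $\mathcal G^0\subseteq\mathcal G^1$, source $s$, range $r$) is étale if $s:\mathcal G^1\to\mathcal G^0$ is a local homeomorphism, and ample if moreover $\mathcal G^0$ is Hausdorff with a basis of compact open sets ($\mathcal G^1$ need not be Hausdorff; "compact" includes Hausdorff). A bisection is an open $U\subseteq\mathcal G^1$ on which $s,r$ are injective. $K\mathcal G$ (the Steinberg algebra) is the $K$-span of characteristic functions $1_U:\mathcal G^1\to K$ of compact open bisections with product $(f\ast g)(\gamma)=\sum_{s(\alpha)=s(\gamma)}f(\gamma\alpha^{-1})g(\alpha)$. The orbit $\mathcal O_u$ is the set of $v\in\mathcal G^0$ with an arrow $u\to v$. A subset $Y\subseteq\mathcal G^0$ is invariant if it is a union of orbits; $\mathcal G|_Y$ is then the subgroupoid with objects $Y$ and arrows $s^{-1}(Y)$, with the relative topology. For $U$ open invariant, $K\mathcal G|_U$ is identified (via extension by zero) with an ideal of $K\mathcal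 G$. For $X$ closed invariant, $\mathcal G|_X$ is ample and restriction of functions gives a surjective homomorphism $K\mathcal G\to K\mathcal G|_X$ with kernel $K\mathcal G|_{\mathcal G^0\setminus X}$; this is the quotient map. A $\mathcal G$-sheaf is a space $E$ with a local homeomorphism $p:E\to\mathcal G^0$ and a continuous action map $\mathcal G^1\times_{\mathcal G^0}E\to E$, $(\gamma,e)\mapsto\gamma e$ (fiber product with respect to $s$ and $p$), such that $p(e)e=e$; $p(\gamma e)=r(\gamma)$ when $p(e)=s(\gamma)$; $\gamma(\alpha e)=(\gamma\alpha)e$ when $p(e)=s(\alpha)$, $s(\gamma)=r(\alpha)$. It is a $\mathcal G$-sheaf of $K$-vector spaces if each stalk $E_u=p^{-1}(u)$ is a $K$-vector space such that the zero section $u\mapsto 0_u$, fiberwise addition $E\times_{\mathcal G^0}E\to E$ and scalar multiplication $K\times E\to E$ ($K$ discrete) are continuous and each map $E_{s(\gamma)}\to E_{r(\gamma)}$, $e\mapsto\gamma e$, is linear. $\Gamma_c(E)$ is the $K$-vector space of continuous sections $t:\mathcal G^0\to E$ of $p$ with compact support $\{u: t(u)\ne0_u\}$; it is a $K\mathcal G$-module via $(ft)(v)=\sum_{\gamma:u\to v}f(\gamma)\,\gamma t(u)$, the sum being over all arrows $\gamma$ with range $v$ and $u=s(\gamma)$. A module $M$ over a ring $R$ is simple if $RM\ne0$ and its only submodules are $0$ and $M$. $(E,p)$ is simple if the $K\mathcal G$-module $\Gamma_c(E)$ is simple; equivalently (since $E\mapsto\Gamma_c(E)$ is an equivalence of $\mathcal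 G$-sheaves of $K$-vector spaces with unitary $K\mathcal G$-modules), $(E,p)$ is non-zero and has no proper non-zero subsheaf, a subsheaf being an open subspace $E'\subseteq E$ with each $E'_u$ a linear subspace of $E_u$ and $\gamma E'_{s(\gamma)}\subseteq E'_{r(\gamma)}$ for all $\gamma$. $\mathrm{supp}(E)=\{u\in\mathcal G^0: E_u\ne\{0_u\}\}$. $\mathrm{ann}(M)$ is the annihilator of $M$. *)

theory Defs
  imports "HOL-Analysis.T1_Spaces" "HOL-Algebra.Module"
begin

section \<open>Topology\<close>

text \<open>Compactness includes the Hausdorff property.\<close>

definition compact_hausdorff_in :: "'a topology \<Rightarrow> 'a set \<Rightarrow> bool" where
  "compact_hausdorff_in T S \<longleftrightarrow> compactin T S \<and> Hausdorff_space (subtopology T S)"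

definition local_homeomorphism :: "'a topology \<Rightarrow> 'b topology \<Rightarrow> ('a \<Rightarrow> 'b) \<Rightarrow> bool" where
  "local_homeomorphism S T f \<longleftrightarrow>
     (\<forall>x \<in> topspace S. \<exists>U. openin S U \<and> x \<in> U \<and> openin T (f ` U) \<and>
        homeomorphic_map (subtopology S U) (subtopology T (f ` U)) f)"


section \<open>Topological groupoids\<close>

text \<open>The arrow space is the topological space given by \<open>arrow_topology\<close>, and the unit space is a
  subset of it with the relative topology. An arrow \<open>\<gamma>\<close> goes from \<open>src G \<gamma>\<close> to \<open>rng G \<gamma>\<close>, and
  \<open>comp G \<gamma> \<alpha>\<close> (first \<open>\<alpha>\<close>, then \<open>\<gamma>\<close>) is meaningful when \<open>src G \<gamma> = rng G \<alpha>\<close>.\<close>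

record 'a groupoid =
  arrow_topology :: "'a topology"
  unit_set :: "'a set"
  src :: "'a \<Rightarrow> 'a"
  rng :: "'a \<Rightarrow> 'a"
  comp :: "'a \<Rightarrow> 'a \<Rightarrow> 'a"
  ginv :: "'a \<Rightarrow> 'a"

definition arrows :: "'a groupoid \<Rightarrow> 'a set" where
  "arrows G = topspace (arrow_topology G)"

definition unit_space :: "'a groupoid \<Rightarrow> 'a topology" where
  "unit_space G = subtopology (arrow_topology G) (unit_set G)"

locale topological_groupoid =
  fixes G :: "'a groupoid"
  assumes units_subset: "unit_set G \<subseteq> arrows G"
    and src_in_units: "\<gamma> \<in> arrows G \<Longrightarrow> src G \<gamma> \<in> unit_set G"
    and rng_in_units: "\<gamma> \<in> arrows G \<Longrightarrow> rng G \<gamma> \<in> unit_set G"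
    and src_unit: "u \<in> unit_set G \<Longrightarrow> src G u = u"
    and rng_unit: "u \<in> unit_set G \<Longrightarrow> rng G u = u"
    and comp_closed: "\<lbrakk>\<gamma> \<in> arrows G; \<alpha> \<in> arrows G; src G \<gamma> = rng G \<alpha>\<rbrakk> \<Longrightarrow> comp G \<gamma> \<alpha> \<in> arrows G"
    and src_comp: "\<lbrakk>\<gamma> \<in> arrows G; \<alpha> \<in> arrows G; src G \<gamma> = rng G \<alpha>\<rbrakk> \<Longrightarrow> src G (comp G \<gamma> \<alpha>) = src G \<alpha>"
    and rng_comp: "\<lbrakk>\<gamma> \<in> arrows G; \<alpha> \<in> arrows G; src G \<gamma> = rng G \<alpha>\<rbrakk> \<Longrightarrow> rng G (comp G \<gamma> \<alpha>) = rng G \<gamma>"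
    and comp_assoc:
      "\<lbrakk>\<gamma> \<in> arrows G; \<alpha> \<in> arrows G; \<beta> \<in> arrows G; src G \<gamma> = rng G \<alpha>; src G \<alpha> = rng G \<beta>\<rbrakk>
        \<Longrightarrow> comp G (comp G \<gamma> \<alpha>) \<beta> = comp G \<gamma> (comp G \<alpha> \<beta>)"
    and comp_src: "\<gamma> \<in> arrows G \<Longrightarrow> comp G \<gamma> (src G \<gamma>) = \<gamma>"
    and comp_rng: "\<gamma> \<in> arrows G \<Longrightarrow> comp G (rng G \<gamma>) \<gamma> = \<gamma>"
    and ginv_closed: "\<gamma> \<in> arrows G \<Longrightarrow> ginv G \<gamma> \<in> arrows G"
    and src_ginv: "\<gamma> \<in> arrows G \<Longrightarrow> src G (ginv G \<gamma>) = rng G \<gamma>"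
    and rng_ginv: "\<gamma> \<in> arrows G \<Longrightarrow> rng G (ginv G \<gamma>) = src G \<gamma>"
    and comp_ginv: "\<gamma> \<in> arrows G \<Longrightarrow> comp G \<gamma> (ginv G \<gamma>) = rng G \<gamma>"
    and ginv_comp: "\<gamma> \<in> arrows G \<Longrightarrow> comp G (ginv G \<gamma>) \<gamma> = src G \<gamma>"
    and continuous_src: "continuous_map (arrow_topology G) (unit_space G) (src G)"
    and continuous_rng: "continuous_map (arrow_topology G) (unit_space G) (rng G)"
    and continuous_comp:
      "continuous_map
        (subtopology (prod_topology (arrow_topology G) (arrow_topology G))
           {(\<gamma>, \<alpha>). src G \<gamma> = rng G \<alpha>})
        (arrow_topology G) (\<lambda>(\<gamma>, \<alpha>). comp G \<gamma> \<alpha>)"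
    and continuous_ginv: "continuous_map (arrow_topology G) (arrow_topology G) (ginv G)"

locale etale_groupoid = topological_groupoid +
  assumes src_local_homeo: "local_homeomorphism (arrow_topology G) (unit_space G) (src G)"

locale ample_groupoid = etale_groupoid +
  assumes units_Hausdorff: "Hausdorff_space (unit_space G)"
    and units_basis:
      "openin (unit_space G) =
         arbitrary union_of (\<lambda>V. openin (unit_space G) V \<and> compact_hausdorff_in (unit_space G) V)"

definition orbit :: "'a groupoid \<Rightarrow> 'a \<Rightarrow> 'a set" where
  "orbit G u = {v \<in> unit_set G. \<exists>\<gamma> \<in> arrows G. src G \<gamma> = u \<and> rng G \<gamma> = v}"

definition invariant :: "'a groupoid \<Rightarrow> 'a set \<Rightarrow> bool" where
  "invariant G Y \<longleftrightarrow> (\<exists>S \<subseteq> unit_set G. Y = (\<Union>u \<in> S. orbit G u))"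

definition restrict_groupoid :: "'a groupoid \<Rightarrow> 'a set \<Rightarrow> 'a groupoid" where
  "restrict_groupoid G Y =
     G\<lparr>arrow_topology := subtopology (arrow_topology G) {\<gamma>. src G \<gamma> \<in> Y}, unit_set := Y\<rparr>"

definition bisection :: "'a groupoid \<Rightarrow> 'a set \<Rightarrow> bool" where
  "bisection G U \<longleftrightarrow> openin (arrow_topology G) U \<and> inj_on (src G) U \<and> inj_on (rng G) U"

definition compact_open_bisection :: "'a groupoid \<Rightarrow> 'a set \<Rightarrow> bool" where
  "compact_open_bisection G U \<longleftrightarrow> bisection G U \<and> compact_hausdorff_in (arrow_topology G) U"


section \<open>Modules over rings that need not have a unit\<close>

text \<open>Rings and modules are given by the records of \<open>HOL-Algebra\<close>, but the field \<open>one\<close> of the ring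
  is ignored, as are the fields \<open>mult\<close> and \<open>one\<close> of the module.\<close>

locale nonunital_ring = abelian_group R for R (structure) +
  assumes mult_closed: "\<lbrakk>x \<in> carrier R; y \<in> carrier R\<rbrakk> \<Longrightarrow> x \<otimes> y \<in> carrier R"
    and mult_assoc:
      "\<lbrakk>x \<in> carrier R; y \<in> carrier R; z \<in> carrier R\<rbrakk> \<Longrightarrow> (x \<otimes> y) \<otimes> z = x \<otimes> (y \<otimes> z)"
    and mult_l_distr:
      "\<lbrakk>x \<in> carrier R; y \<in> carrier R; z \<in> carrier R\<rbrakk> \<Longrightarrow> (x \<oplus> y) \<otimes> z = x \<otimes> z \<oplus> y \<otimes> z"
    and mult_r_distr:
      "\<lbrakk>x \<in> carrier R; y \<in> carrier R; z \<in> carrier R\<rbrakk> \<Longrightarrow> z \<otimes> (x \<oplus> y) = z \<otimes> x \<oplus> z \<otimes> y"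

locale nonunital_module = R?: nonunital_ring R + M?: abelian_group M
  for R (structure) and M :: "('r, 'm, 'x) module_scheme" (structure) +
  assumes act_closed: "\<lbrakk>a \<in> carrier R; x \<in> carrier M\<rbrakk> \<Longrightarrow> a \<odot>\<^bsub>M\<^esub> x \<in> carrier M"
    and act_l_distr:
      "\<lbrakk>a \<in> carrier R; b \<in> carrier R; x \<in> carrier M\<rbrakk>
        \<Longrightarrow> (a \<oplus>\<^bsub>R\<^esub> b) \<odot>\<^bsub>M\<^esub> x = a \<odot>\<^bsub>M\<^esub> x \<oplus>\<^bsub>M\<^esub> b \<odot>\<^bsub>M\<^esub> x"
    and act_r_distr:
      "\<lbrakk>a \<in> carrier R; x \<in> carrier M; y \<in> carrier M\<rbrakk>
        \<Longrightarrow> a \<odot>\<^bsub>M\<^esub> (x \<oplus>\<^bsub>M\<^esub> y) = a \<odot>\<^bsub>M\<^esub> x \<oplus>\<^bsub>M\<^esub> a \<odot>\<^bsub>M\<^esub> y"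
    and act_assoc:
      "\<lbrakk>a \<in> carrier R; b \<in> carrier R; x \<in> carrier M\<rbrakk>
        \<Longrightarrow> (a \<otimes>\<^bsub>R\<^esub> b) \<odot>\<^bsub>M\<^esub> x = a \<odot>\<^bsub>M\<^esub> (b \<odot>\<^bsub>M\<^esub> x)"

locale simple_module = nonunital_module +
  assumes act_nonzero: "\<exists>a \<in> carrier R. \<exists>x \<in> carrier M. a \<odot>\<^bsub>M\<^esub> x \<noteq> \<zero>\<^bsub>M\<^esub>"
    and only_trivial_submodules: "submodule N R M \<Longrightarrow> N = {\<zero>\<^bsub>M\<^esub>} \<or> N = carrier M"

definition annihilator :: "('r, 'y) ring_scheme \<Rightarrow> ('r, 'm, 'x) module_scheme \<Rightarrow> 'r set" where
  "annihilator R M = {a \<in> carrier R. \<forall>x \<in> carrier M. a \<odot>\<^bsub>M\<^esub> x = \<zero>\<^bsub>M\<^esub>}"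


section \<open>Steinberg algebras\<close>

text \<open>A function from the arrow space to the field is represented by a function on the whole type
  that vanishes off the arrow space. Hence extension by zero of functions on a subgroupoid is the
  identity.\<close>

definition char_fun :: "('k, 'z) ring_scheme \<Rightarrow> 'a set \<Rightarrow> 'a \<Rightarrow> 'k" where
  "char_fun K U = (\<lambda>\<gamma>. if \<gamma> \<in> U then \<one>\<^bsub>K\<^esub> else \<zero>\<^bsub>K\<^esub>)"

text \<open>The convolution sum is restricted to the arrows on which the second factor does not vanish, as
  \<open>finsum\<close> is only meaningful for finite index sets; there are finitely many of them, because the
  source map is injective on bisections. The field \<open>one\<close> is the identity of the algebra only
  when the unit space is compact.\<close>

definition steinberg_algebra :: "('k, 'z) ring_scheme \<Rightarrow> 'a groupoid \<Rightarrow> ('a \<Rightarrow> 'k) ring" where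
  "steinberg_algebra K G =
     \<lparr>carrier = {f. \<exists>F c. finite F \<and> (\<forall>U \<in> F. compact_open_bisection G U) \<and> c \<in> F \<rightarrow> carrier K \<and>
                  f = (\<lambda>\<gamma>. \<Oplus>\<^bsub>K\<^esub>U\<in>F. c U \<otimes>\<^bsub>K\<^esub> char_fun K U \<gamma>)},
      mult = (\<lambda>f g \<gamma>. if \<gamma> \<in> arrows G
                then \<Oplus>\<^bsub>K\<^esub>\<alpha>\<in>{\<alpha> \<in> arrows G. src G \<alpha> = src G \<gamma> \<and> g \<alpha> \<noteq> \<zero>\<^bsub>K\<^esub>}.
                       f (comp G \<gamma> (ginv G \<alpha>)) \<otimes>\<^bsub>K\<^esub> g \<alpha>
                else \<zero>\<^bsub>K\<^esub>),
      one = char_fun K (unit_set G),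
      zero = (\<lambda>_. \<zero>\<^bsub>K\<^esub>),
      add = (\<lambda>f g \<gamma>. f \<gamma> \<oplus>\<^bsub>K\<^esub> g \<gamma>)\<rparr>"

definition steinberg_quotient ::
    "('k, 'z) ring_scheme \<Rightarrow> 'a groupoid \<Rightarrow> 'a set \<Rightarrow> ('a \<Rightarrow> 'k) \<Rightarrow> ('a \<Rightarrow> 'k)" where
  "steinberg_quotient K G X f =
     (\<lambda>\<gamma>. if \<gamma> \<in> arrows (restrict_groupoid G X) then f \<gamma> else \<zero>\<^bsub>K\<^esub>)"


section \<open>Sheaves of vector spaces\<close>

record ('a, 'k, 'e) gsheaf =
  total_space :: "'e topology"
  proj :: "'e \<Rightarrow> 'a"
  zero_section :: "'a \<Rightarrow> 'e"
  fib_add :: "'e \<Rightarrow> 'e \<Rightarrow> 'e"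
  fib_scale :: "'k \<Rightarrow> 'e \<Rightarrow> 'e"
  action :: "'a \<Rightarrow> 'e \<Rightarrow> 'e"

definition stalk :: "('a, 'k, 'e) gsheaf \<Rightarrow> 'a \<Rightarrow> ('k, 'e) module" where
  "stalk E u =
     \<lparr>carrier = {e \<in> topspace (total_space E). proj E e = u},
      mult = undefined, one = undefined,
      zero = zero_section E u, add = fib_add E, smult = fib_scale E\<rparr>"

locale gsheaf =
  fixes G :: "'a groupoid" and E :: "('a, 'k, 'e) gsheaf"
  assumes proj_local_homeo: "local_homeomorphism (total_space E) (unit_space G) (proj E)"
    and continuous_action:
      "continuous_map
        (subtopology (prod_topology (arrow_topology G) (total_space E))
           {(\<gamma>, e). src G \<gamma> = proj E e})
        (total_space E) (\<lambda>(\<gamma>, e). action E \<gamma> e)"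
    and action_unit: "e \<in> topspace (total_space E) \<Longrightarrow> action E (proj E e) e = e"
    and proj_action:
      "\<lbrakk>\<gamma> \<in> arrows G; e \<in> topspace (total_space E); proj E e = src G \<gamma>\<rbrakk>
        \<Longrightarrow> proj E (action E \<gamma> e) = rng G \<gamma>"
    and action_comp:
      "\<lbrakk>\<gamma> \<in> arrows G; \<alpha> \<in> arrows G; e \<in> topspace (total_space E);
        proj E e = src G \<alpha>; src G \<gamma> = rng G \<alpha>\<rbrakk>
        \<Longrightarrow> action E \<gamma> (action E \<alpha> e) = action E (comp G \<gamma> \<alpha>) e"

text \<open>For a field \<open>K\<close>, the locale \<open>module\<close> of \<open>HOL-Algebra\<close> describes vector spaces over \<open>K\<close>.\<close>

locale gsheaf_vector_spaces = gsheaf G E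
  for K :: "('k, 'z) ring_scheme" and G :: "'a groupoid" and E :: "('a, 'k, 'e) gsheaf" +
  assumes stalk_vector_space: "u \<in> unit_set G \<Longrightarrow> module K (stalk E u)"
    and continuous_zero_section: "continuous_map (unit_space G) (total_space E) (zero_section E)"
    and continuous_fib_add:
      "continuous_map
        (subtopology (prod_topology (total_space E) (total_space E))
           {(e, e'). proj E e = proj E e'})
        (total_space E) (\<lambda>(e, e'). fib_add E e e')"
    and continuous_fib_scale:
      "continuous_map
        (prod_topology (discrete_topology (carrier K)) (total_space E))
        (total_space E) (\<lambda>(c, e). fib_scale E c e)"
    and action_add:
      "\<lbrakk>\<gamma> \<in> arrows G; e \<in> carrier (stalk E (src G \<gamma>)); e' \<in> carrier (stalk E (src G \<gamma>))\<rbrakk>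
        \<Longrightarrow> action E \<gamma> (fib_add E e e') = fib_add E (action E \<gamma> e) (action E \<gamma> e')"
    and action_scale:
      "\<lbrakk>\<gamma> \<in> arrows G; c \<in> carrier K; e \<in> carrier (stalk E (src G \<gamma>))\<rbrakk>
        \<Longrightarrow> action E \<gamma> (fib_scale E c e) = fib_scale E c (action E \<gamma> e)"

definition sheaf_support :: "'a groupoid \<Rightarrow> ('a, 'k, 'e) gsheaf \<Rightarrow> 'a set" where
  "sheaf_support G E = {u \<in> unit_set G. carrier (stalk E u) \<noteq> {zero_section E u}}"

text \<open>A section is a function on the unit space, extended by \<open>undefined\<close> to the whole type. The sum
  in the module structure is taken in the stalk over \<open>v\<close>; as for the convolution, it is restricted
  to the arrows with range \<open>v\<close> on which \<open>f\<close> does not vanish, of which there are finitely many.\<close>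

definition compact_sections ::
    "('k, 'z) ring_scheme \<Rightarrow> 'a groupoid \<Rightarrow> ('a, 'k, 'e) gsheaf \<Rightarrow> ('a \<Rightarrow> 'k, 'a \<Rightarrow> 'e) module" where
  "compact_sections K G E =
     \<lparr>carrier = {t \<in> extensional (unit_set G).
                  continuous_map (unit_space G) (total_space E) t \<and>
                  (\<forall>u \<in> unit_set G. proj E (t u) = u) \<and>
                  compact_hausdorff_in (unit_space G) {u \<in> unit_set G. t u \<noteq> zero_section E u}},
      mult = undefined, one = undefined,
      zero = (\<lambda>u\<in>unit_set G. zero_section E u),
      add = (\<lambda>t t'. \<lambda>u\<in>unit_set G. fib_add E (t u) (t' u)),
      smult = (\<lambda>f t. \<lambda>v\<in>unit_set G.
                 \<Oplus>\<^bsub>stalk E v\<^esub>\<gamma>\<in>{\<gamma> \<in> arrows G. rng G \<gamma> = v \<and> f \<gamma> \<noteq> \<zero>\<^bsub>K\<^esub>}.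
                   fib_scale E (f \<gamma>) (action E \<gamma> (t (src G \<gamma>))))\<rparr>"

definition simple_gsheaf ::
    "('k, 'z) ring_scheme \<Rightarrow> 'a groupoid \<Rightarrow> ('a, 'k, 'e) gsheaf \<Rightarrow> bool" where
  "simple_gsheaf K G E \<longleftrightarrow>
     gsheaf_vector_spaces K G E \<and> simple_module (steinberg_algebra K G) (compact_sections K G E)"

end

theory Submission
  imports Defs
begin

text \<open>The sections vanishing on an orbit \<open>O\<^sub>u\<close> form a submodule of \<open>\<Gamma>\<^sub>c(E)\<close>. When \<open>u\<close> is in the
  support it is proper, as there is a section through a nonzero point of \<open>E\<^sub>u\<close>; by simplicity it
  is zero. A point of the support outside the closure of \<open>O\<^sub>u\<close> would however carry a nonzero section
  supported in a compact open neighbourhood disjoint from \<open>O\<^sub>u\<close>.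

  Every section vanishes off \<open>X\<close>, so \<open>ft\<close> only depends on the restriction of \<open>f\<close> to \<open>G|\<^sub>X\<close>, and the
  defining formula of the action gives the action of the quotient as well. That the Steinberg
  algebra of \<open>G|\<^sub>X\<close> is a ring with \<open>\<Gamma>\<^sub>c(E)\<close> as a simple module is inherited along the restriction
  map, which is a surjective homomorphism.\<close>

section \<open>Local homeomorphisms\<close>

text \<open>Intersecting a chart around \<open>x\<close> with \<open>W\<close> leaves a chart,
  because a homeomorphism onto an open set has open images. The local inverse \<open>g\<close> is
  named explicitly: it later yields compactness of pieces of bisections and local sections of a
  sheaf.\<close>

lemma local_homeomorphism_openE:
  assumes "local_homeomorphism S T f" "openin S W" "x \<in> W"
  obtains U g where "openin S U" "x \<in> U" "U \<subseteq> W" "openin T (f ` U)" "inj_on f U"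
    "continuous_map (subtopology T (f ` U)) S g" "\<forall>y\<in>U. g (f y) = y"
proof -
  have "x \<in> topspace S" using assms openin_subset by blast
  then obtain V where V: "openin S V" "x \<in> V" "openin T (f ` V)"
    "homeomorphic_map (subtopology S V) (subtopology T (f ` V)) f"
    using assms(1) unfolding local_homeomorphism_def by blast
  obtain g where g: "homeomorphic_maps (subtopology S V) (subtopology T (f ` V)) f g"
    using V(4) homeomorphic_map_maps by blast
  have top: "topspace (subtopology S V) = V"
    using V(1) openin_subset by fastforce
  let ?U = "V \<inter> W"
  have "openin (subtopology S V) ?U" using V(1) assms(2) by (simp add: openin_open_subtopology openin_Int)
  then have "openin (subtopology T (f ` V)) (f ` ?U)"
    using homeomorphic_imp_open_map[OF V(4)] by (auto simp: open_map_def)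
  then have op: "openin T (f ` ?U)" using V(3) by (simp add: openin_open_subtopology)
  have inj: "inj_on f V" using homeomorphic_imp_injective_map[OF V(4)] top by simp
  have "continuous_map (subtopology T (f ` V)) S g"
    using g by (auto simp: homeomorphic_maps_def continuous_map_in_subtopology)
  then have "continuous_map (subtopology T (f ` ?U)) S g"
    by (rule continuous_map_from_subtopology_mono) auto
  moreover have "\<forall>y\<in>?U. g (f y) = y"
    using g top by (auto simp: homeomorphic_maps_def)
  ultimately show thesis
    using that[of ?U g] V(1,2) assms(2,3) op inj by (auto simp: openin_Int inj_on_Int)
qed

text \<open>The image is a union of the open images of small charts inside \<open>W\<close>.\<close>

lemma local_homeomorphism_open_image:
  assumes "local_homeomorphism S T f" "openin S W"
  shows "openin T (f ` W)"
proof (subst openin_subopen, intro ballI)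
  fix y assume "y \<in> f ` W"
  then obtain x where "x \<in> W" "y = f x" by blast
  then show "\<exists>V. openin T V \<and> y \<in> V \<and> V \<subseteq> f ` W"
    using local_homeomorphism_openE[OF assms] by (metis image_eqI image_mono)
qed

text \<open>Near a point of agreement both maps take values in a single chart of \<open>p\<close>,
  and injectivity of \<open>p\<close> there forces them to be equal. Compared with the zero section,
  this shows that the support of a section is closed.\<close>

lemma openin_sections_agree:
  assumes p: "local_homeomorphism S T p"
    and t: "continuous_map T S t" "continuous_map T S t'"
    and pt: "\<And>u. u \<in> topspace T \<Longrightarrow> p (t u) = p (t' u)"
  shows "openin T {u \<in> topspace T. t u = t' u}"
proof (subst openin_subopen, intro ballI)
  fix u assume u: "u \<in> {u \<in> topspace T. t u = t' u}"
  then have "t u \<in> topspace S" using continuous_map_image_subset_topspace[OF t(1)] by blast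
  then obtain U where U: "openin S U" "t u \<in> U" "inj_on p U"
    using local_homeomorphism_openE[OF p openin_topspace] by metis
  let ?O = "{v \<in> topspace T. t v \<in> U} \<inter> {v \<in> topspace T. t' v \<in> U}"
  have "openin T ?O" using U(1) t by (intro openin_Int) (auto intro: openin_continuous_map_preimage)
  moreover have "u \<in> ?O" using u U(2) by auto
  moreover have "?O \<subseteq> {u \<in> topspace T. t u = t' u}" using U(3) pt by (auto dest: inj_onD)
  ultimately show "\<exists>V. openin T V \<and> u \<in> V \<and> V \<subseteq> {u \<in> topspace T. t u = t' u}" by blast
qed

lemma compact_hausdorff_in_closed_Int:
  assumes "compact_hausdorff_in T U" "closedin T C"
  shows "compact_hausdorff_in T (U \<inter> C)"
  using assms closed_Int_compactin[of T C U] Hausdorff_space_subtopology[of "subtopology T U" C]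
  by (auto simp: compact_hausdorff_in_def subtopology_subtopology Int_commute)

lemma compact_hausdorff_in_subtopology:
  "compact_hausdorff_in (subtopology T Y) U \<longleftrightarrow> compact_hausdorff_in T U \<and> U \<subseteq> Y"
  by (auto simp: compact_hausdorff_in_def compactin_subtopology subtopology_subtopology inf.absorb2)


section \<open>Ample groupoids\<close>

lemma (in topological_groupoid) topspace_unit_space: "topspace (unit_space G) = unit_set G"
  using units_subset by (auto simp: unit_space_def arrows_def)

lemma (in topological_groupoid) src_preimage_openin:
  "openin (unit_space G) W \<Longrightarrow> openin (arrow_topology G) {\<gamma> \<in> arrows G. src G \<gamma> \<in> W}"
  unfolding arrows_def by (rule openin_continuous_map_preimage[OF continuous_src])

lemma (in topological_groupoid) src_preimage_closedin:
  "closedin (unit_space G) W \<Longrightarrow> closedin (arrow_topology G) {\<gamma> \<in> arrows G. src G \<gamma> \<in> W}"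
  unfolding arrows_def by (rule closedin_continuous_map_preimage[OF continuous_src])

lemma (in topological_groupoid) rng_preimage_openin:
  "openin (unit_space G) W \<Longrightarrow> openin (arrow_topology G) {\<gamma> \<in> arrows G. rng G \<gamma> \<in> W}"
  unfolding arrows_def by (rule openin_continuous_map_preimage[OF continuous_rng])

lemma (in topological_groupoid) ginv_ginv: "\<gamma> \<in> arrows G \<Longrightarrow> ginv G (ginv G \<gamma>) = \<gamma>"
proof -
  assume g: "\<gamma> \<in> arrows G"
  let ?a = "ginv G \<gamma>" let ?b = "ginv G ?a"
  have "?b = comp G ?b (comp G ?a \<gamma>)"
    using g by (metis comp_src ginv_closed ginv_comp rng_ginv src_ginv)
  also have "\<dots> = comp G (comp G ?b ?a) \<gamma>"
    using g by (metis comp_assoc ginv_closed rng_ginv src_ginv)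
  also have "\<dots> = \<gamma>"
    using g by (metis comp_rng ginv_closed ginv_comp src_ginv)
  finally show ?thesis .
qed

section \<open>Orbits and invariant sets\<close>

lemma (in topological_groupoid) orbit_refl: "u \<in> unit_set G \<Longrightarrow> u \<in> orbit G u"
  using units_subset src_unit rng_unit by (auto simp: orbit_def)

lemma (in topological_groupoid) orbit_trans:
  assumes "v \<in> orbit G u" "w \<in> orbit G v"
  shows "w \<in> orbit G u"
proof -
  obtain \<alpha> \<beta> where "\<alpha> \<in> arrows G" "src G \<alpha> = u" "rng G \<alpha> = v"
    "\<beta> \<in> arrows G" "src G \<beta> = v" "rng G \<beta> = w" "w \<in> unit_set G"
    using assms by (auto simp: orbit_def)
  then show ?thesis
    by (auto simp: orbit_def src_comp rng_comp comp_closed intro!: bexI[of _ "comp G \<beta> \<alpha>"])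
qed

lemma (in topological_groupoid) rng_in_orbit: "\<gamma> \<in> arrows G \<Longrightarrow> rng G \<gamma> \<in> orbit G (src G \<gamma>)"
  using rng_in_units by (auto simp: orbit_def)

lemma (in topological_groupoid) src_in_orbit: "\<gamma> \<in> arrows G \<Longrightarrow> src G \<gamma> \<in> orbit G (rng G \<gamma>)"
  using rng_in_orbit[OF ginv_closed] by (simp add: rng_ginv src_ginv)

text \<open>The set \<open>Y\<close> serves as its own index set: the orbits of its points stay
  inside it, and each point lies in its own orbit.\<close>

lemma (in topological_groupoid) invariantI:
  assumes "Y \<subseteq> unit_set G"
    and "\<And>\<gamma>. \<gamma> \<in> arrows G \<Longrightarrow> src G \<gamma> \<in> Y \<Longrightarrow> rng G \<gamma> \<in> Y"
  shows "invariant G Y"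
  unfolding invariant_def
proof (intro exI[of _ Y] conjI)
  show "Y = (\<Union>u\<in>Y. orbit G u)"
    using assms orbit_refl by (fastforce simp: orbit_def)
qed (fact assms(1))

text \<open>The arrows with range in a neighbourhood \<open>V\<close> of the range of
  \<open>\<gamma>\<close> form an open set, and the source map is open. Their sources therefore form
  a neighbourhood of the source of \<open>\<gamma>\<close>, which meets \<open>S\<close>; an arrow
  starting at a common point ends in both \<open>S\<close> and \<open>V\<close>.\<close>

lemma (in etale_groupoid) rng_in_closure:
  assumes S: "S \<subseteq> unit_set G" "\<And>\<gamma>. \<gamma> \<in> arrows G \<Longrightarrow> src G \<gamma> \<in> S \<Longrightarrow> rng G \<gamma> \<in> S"
    and \<gamma>: "\<gamma> \<in> arrows G" "src G \<gamma> \<in> unit_space G closure_of S"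
  shows "rng G \<gamma> \<in> unit_space G closure_of S"
  unfolding in_closure_of
proof (intro conjI allI impI)
  show "rng G \<gamma> \<in> topspace (unit_space G)" using \<gamma>(1) rng_in_units topspace_unit_space by simp
  fix V assume V: "rng G \<gamma> \<in> V \<and> openin (unit_space G) V"
  let ?W = "{\<delta> \<in> arrows G. rng G \<delta> \<in> V}"
  have "openin (unit_space G) (src G ` ?W)"
    by (rule local_homeomorphism_open_image[OF src_local_homeo]) (use V rng_preimage_openin in auto)
  moreover have "src G \<gamma> \<in> src G ` ?W" using V \<gamma>(1) by auto
  ultimately obtain w where "w \<in> S" "w \<in> src G ` ?W" using \<gamma>(2) by (meson in_closure_of)
  then show "\<exists>y. y \<in> S \<and> y \<in> V" using S(2) by blast
qed

section \<open>Small compact open sets of units and of arrows\<close>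

lemma (in ample_groupoid) compact_open_nhd:
  assumes "openin (unit_space G) W" "u \<in> W"
  obtains V where "openin (unit_space G) V" "compact_hausdorff_in (unit_space G) V" "u \<in> V" "V \<subseteq> W"
  using assms units_basis unfolding openin_topology_base_unique by meson

text \<open>First \<open>\<gamma>\<close> gets an open neighbourhood inside \<open>W\<close> on
  which source and range are injective; then its sources are cut down to a compact open set of
  units. The result is compact as the image of that set under a local inverse of the source map, and
  Hausdorff because the source map injects it continuously into the unit space.\<close>

lemma (in ample_groupoid) compact_open_bisection_nhd:
  assumes W: "openin (arrow_topology G) W" "\<gamma> \<in> W"
  obtains B where "compact_open_bisection G B" "\<gamma> \<in> B" "B \<subseteq> W"
proof -
  let ?T = "arrow_topology G"
  have \<gamma>: "\<gamma> \<in> arrows G" using W openin_subset by (auto simp: arrows_def)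
  then have "ginv G \<gamma> \<in> topspace ?T" using ginv_closed by (simp add: arrows_def)
  then obtain U' where U': "openin ?T U'" "ginv G \<gamma> \<in> U'" "inj_on (src G) U'"
    using local_homeomorphism_openE[OF src_local_homeo openin_topspace] by metis
  \<comment> \<open>The range of an arrow is the source of its inverse, so injectivity of the source
    map near the inverse of \<open>\<gamma>\<close> gives injectivity of the range map near
    \<open>\<gamma>\<close>.\<close>
  let ?V = "{\<delta> \<in> topspace ?T. ginv G \<delta> \<in> U'} \<inter> W"
  have V: "openin ?T ?V"
    using openin_continuous_map_preimage[OF continuous_ginv U'(1)] W(1) by (rule openin_Int)
  have injV: "inj_on (rng G) ?V"
  proof (rule inj_onI)
    fix a b assume "a \<in> ?V" "b \<in> ?V" "rng G a = rng G b"
    then have "ginv G a = ginv G b" using U'(3) by (auto simp: src_ginv arrows_def inj_on_def)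
    then show "a = b" using \<open>a \<in> ?V\<close> \<open>b \<in> ?V\<close> ginv_ginv by (metis (no_types, lifting) IntD1 arrows_def mem_Collect_eq)
  qed
  have "\<gamma> \<in> ?V" using \<gamma> U'(2) W(2) by (simp add: arrows_def)
  from local_homeomorphism_openE[OF src_local_homeo V this]
  obtain U g where U: "openin ?T U" "\<gamma> \<in> U" "U \<subseteq> ?V" "openin (unit_space G) (src G ` U)"
      "inj_on (src G) U" "continuous_map (subtopology (unit_space G) (src G ` U)) ?T g"
      "\<forall>y\<in>U. g (src G y) = y"
    by blast
  obtain C where C: "openin (unit_space G) C" "compact_hausdorff_in (unit_space G) C"
      "src G \<gamma> \<in> C" "C \<subseteq> src G ` U"
    using compact_open_nhd[OF U(4)] U(2) by blast
  have UA: "U \<subseteq> arrows G" using U(1) openin_subset by (auto simp: arrows_def)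
  let ?B = "U \<inter> {\<delta> \<in> arrows G. src G \<delta> \<in> C}"
  have B: "openin ?T ?B" by (intro openin_Int U src_preimage_openin C)
  have gC: "?B = g ` C"
  proof
    show "?B \<subseteq> g ` C" using U(7) by force
    show "g ` C \<subseteq> ?B"
    proof
      fix y assume "y \<in> g ` C"
      then obtain c x where "c \<in> C" "y = g c" "x \<in> U" "c = src G x" using C(4) by blast
      then show "y \<in> ?B" using U(7) UA by auto
    qed
  qed
  have "compactin ?T ?B"
    unfolding gC using C(2,4)
    by (intro image_compactin[OF _ U(6)]) (simp add: compactin_subtopology compact_hausdorff_in_def)
  moreover have "Hausdorff_space (subtopology ?T ?B)"
  proof (rule Hausdorff_space_injective_preimage[OF units_Hausdorff])
    show "continuous_map (subtopology ?T ?B) (unit_space G) (src G)"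
      by (rule continuous_map_from_subtopology[OF continuous_src])
    show "inj_on (src G) (topspace (subtopology ?T ?B))"
      using U(5) by (auto simp: inj_on_def)
  qed
  moreover have "inj_on (src G) ?B" "inj_on (rng G) ?B"
    using inj_on_subset[OF U(5), of ?B] inj_on_subset[OF injV, of ?B] U(3) by blast+
  ultimately have "compact_open_bisection G ?B"
    using B by (simp add: compact_open_bisection_def bisection_def compact_hausdorff_in_def)
  moreover have "\<gamma> \<in> ?B" "?B \<subseteq> W" using U(2,3) C(3) \<gamma> by auto
  ultimately show thesis by (rule that)
qed


section \<open>Simple modules along surjective homomorphisms\<close>

text \<open>Each law of \<open>S\<close> is the image of the same law in \<open>R\<close>.
  Preservation of zero is a separate hypothesis, since \<open>S\<close> is not yet known to be a
  group.\<close>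

lemma nonunital_ring_hom_image:
  fixes R (structure) and S (structure)
  assumes "nonunital_ring R"
    and img: "h ` carrier R = carrier S"
    and zero: "h \<zero>\<^bsub>R\<^esub> = \<zero>\<^bsub>S\<^esub>"
    and add: "\<And>x y. x \<in> carrier R \<Longrightarrow> y \<in> carrier R \<Longrightarrow> h (x \<oplus>\<^bsub>R\<^esub> y) = h x \<oplus>\<^bsub>S\<^esub> h y"
    and mult: "\<And>x y. x \<in> carrier R \<Longrightarrow> y \<in> carrier R \<Longrightarrow> h (x \<otimes>\<^bsub>R\<^esub> y) = h x \<otimes>\<^bsub>S\<^esub> h y"
  shows "nonunital_ring S"
proof -
  interpret nonunital_ring R by fact
  have lift: "\<exists>x \<in> carrier R. a = h x" if "a \<in> carrier S" for a
    using that img by blast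
  note [simp] = add[symmetric] mult[symmetric] zero[symmetric] mult_closed
  have h_closed: "h x \<in> carrier S" if "x \<in> carrier R" for x using that img by blast
  show ?thesis
  proof (intro nonunital_ring.intro nonunital_ring_axioms.intro abelian_groupI)
    show "\<exists>y\<in>carrier S. y \<oplus>\<^bsub>S\<^esub> x = \<zero>\<^bsub>S\<^esub>" if "x \<in> carrier S" for x
      using lift[OF that] h_closed by (auto intro!: bexI[of _ "h (\<ominus>\<^bsub>R\<^esub> _)"] simp: l_neg)
    show "x \<oplus>\<^bsub>S\<^esub> y = y \<oplus>\<^bsub>S\<^esub> x" if xy: "x \<in> carrier S" "y \<in> carrier S" for x y
    proof -
      obtain a b where "a \<in> carrier R" "b \<in> carrier R" "x = h a" "y = h b"
        using lift[OF xy(1)] lift[OF xy(2)] by blast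
      then show ?thesis using a_comm[of a b] by simp
    qed
  qed (auto dest!: lift simp: h_closed a_assoc mult_assoc mult_l_distr mult_r_distr)
qed

text \<open>Every scalar of \<open>S\<close> is some \<open>h a\<close> and acts as \<open>a\<close>
  does, so the module laws carry over and a submodule over \<open>S\<close> is a submodule over
  \<open>R\<close>. The hypothesis on \<open>act\<close> already expresses that the action of
  \<open>R\<close> factors through \<open>h\<close>.\<close>

lemma simple_module_hom_image:
  fixes R (structure) and S (structure) and M (structure)
  assumes "simple_module R M"
    and img: "h ` carrier R = carrier S"
    and zero: "h \<zero>\<^bsub>R\<^esub> = \<zero>\<^bsub>S\<^esub>"
    and add: "\<And>x y. x \<in> carrier R \<Longrightarrow> y \<in> carrier R \<Longrightarrow> h (x \<oplus>\<^bsub>R\<^esub> y) = h x \<oplus>\<^bsub>S\<^esub> h y"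
    and mult: "\<And>x y. x \<in> carrier R \<Longrightarrow> y \<in> carrier R \<Longrightarrow> h (x \<otimes>\<^bsub>R\<^esub> y) = h x \<otimes>\<^bsub>S\<^esub> h y"
    and act: "\<And>a x. a \<in> carrier R \<Longrightarrow> x \<in> carrier M \<Longrightarrow> act (h a) x = a \<odot>\<^bsub>M\<^esub> x"
  shows "simple_module S (M\<lparr>smult := act\<rparr>)"
proof -
  interpret simple_module R M by fact
  interpret S: nonunital_ring S
    by (rule nonunital_ring_hom_image[OF R.nonunital_ring_axioms img zero add mult])
  let ?M = "M\<lparr>smult := act\<rparr>"
  have lift: "\<exists>x \<in> carrier R. a = h x" if "a \<in> carrier S" for a
    using that img by blast
  have grp: "abelian_group ?M"
    using M.abelian_group_axioms
    by (simp add: abelian_group_def abelian_monoid_def abelian_group_axioms_def)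
  have "nonunital_module S ?M"
  proof (intro nonunital_module.intro nonunital_module_axioms.intro S.nonunital_ring_axioms grp)
  qed (auto dest!: lift simp: add[symmetric] mult[symmetric] act act_closed R.mult_closed
         act_l_distr act_r_distr act_assoc)
  moreover have "N = {\<zero>\<^bsub>M\<^esub>} \<or> N = carrier M" if "submodule N S ?M" for N
  proof (rule only_trivial_submodules)
    interpret N: submodule N S ?M by fact
    have sub: "N \<subseteq> carrier M" using N.subset by simp
    show "submodule N R M"
    proof (intro submodule.intro submodule_axioms.intro)
      show "subgroup N (add_monoid M)" using N.subgroup_axioms by simp
      show "a \<odot>\<^bsub>M\<^esub> x \<in> N" if "a \<in> carrier R" "x \<in> N" for a x
      proof -
        have "h a \<in> carrier S" using that(1) img by blast
        then have "act (h a) x \<in> N" using N.smult_closed[of "h a" x] that(2) by simp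
        moreover have "x \<in> carrier M" using that(2) sub by blast
        ultimately show ?thesis using act[OF that(1)] by simp
      qed
    qed
  qed
  moreover have "\<exists>a \<in> carrier S. \<exists>x \<in> carrier M. act a x \<noteq> \<zero>\<^bsub>M\<^esub>"
    using act_nonzero act img by (metis image_eqI)
  ultimately show ?thesis
    by (simp add: simple_module_def simple_module_axioms_def)
qed


section \<open>Restriction of functions in a Steinberg algebra\<close>

text \<open>The fibre has at most one point. When it is empty, the point chosen by
  \<open>THE\<close> is arbitrary and the inclusion is trivial.\<close>

lemma finite_inj_on_fibre: "inj_on f U \<Longrightarrow> finite {x \<in> U. f x = v}"
  by (rule finite_subset[of _ "{THE x. x \<in> U \<and> f x = v}"])
    (auto intro!: the_equality[symmetric] dest: inj_onD)

section \<open>Elements of the Steinberg algebra as finite combinations of bisections\<close>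

lemma (in ring) char_fun_closed: "char_fun R U \<gamma> \<in> carrier R"
  by (simp add: char_fun_def)

text \<open>Induction on the finite family of bisections in a representation of \<open>f\<close>,
  splitting off one term at a time. This makes it possible to argue without choosing
  representations.\<close>

lemma (in ring) steinberg_algebra_induct [consumes 1, case_names zero add]:
  assumes "f \<in> carrier (steinberg_algebra R G)"
    and zero: "P (\<lambda>_. \<zero>)"
    and add: "\<And>U c f. \<lbrakk>compact_open_bisection G U; c \<in> carrier R; f \<in> carrier (steinberg_algebra R G); P f\<rbrakk>
      \<Longrightarrow> P (\<lambda>\<gamma>. c \<otimes> char_fun R U \<gamma> \<oplus> f \<gamma>)"
  shows "P f"
proof -
  obtain F c where "finite F" "\<forall>U\<in>F. compact_open_bisection G U" "c \<in> F \<rightarrow> carrier R"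
    and f: "f = (\<lambda>\<gamma>. \<Oplus>U\<in>F. c U \<otimes> char_fun R U \<gamma>)"
    using assms(1) by (auto simp: steinberg_algebra_def)
  then have "P (\<lambda>\<gamma>. \<Oplus>U\<in>F. c U \<otimes> char_fun R U \<gamma>)"
  proof (induction F arbitrary: f rule: finite_induct)
    case empty
    then show ?case using zero by simp
  next
    case (insert V F)
    let ?f = "\<lambda>\<gamma>. \<Oplus>U\<in>F. c U \<otimes> char_fun R U \<gamma>"
    have "?f \<in> carrier (steinberg_algebra R G)"
      using insert by (auto simp: steinberg_algebra_def)
    moreover have "(\<Oplus>U\<in>insert V F. c U \<otimes> char_fun R U \<gamma>) = c V \<otimes> char_fun R V \<gamma> \<oplus> ?f \<gamma>" for \<gamma>
      using insert by (intro finsum_insert) (auto intro!: m_closed char_fun_closed)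
    moreover have "P ?f" using insert by auto
    ultimately show ?case using add[of V "c V" ?f] insert by auto
  qed
  then show ?thesis using f by simp
qed

lemma (in ring) steinberg_algebra_zero: "(\<lambda>_. \<zero>) \<in> carrier (steinberg_algebra R G)"
  by (auto simp: steinberg_algebra_def intro!: exI[of _ "{}"])

lemma (in ring) steinberg_algebra_add:
  assumes "f \<in> carrier (steinberg_algebra R G)" "g \<in> carrier (steinberg_algebra R G)"
  shows "(\<lambda>\<gamma>. f \<gamma> \<oplus> g \<gamma>) \<in> carrier (steinberg_algebra R G)"
proof -
  obtain F c where F: "finite F" "\<forall>U\<in>F. compact_open_bisection G U" "c \<in> F \<rightarrow> carrier R"
    and f: "f = (\<lambda>\<gamma>. \<Oplus>U\<in>F. c U \<otimes> char_fun R U \<gamma>)"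
    using assms(1) by (auto simp: steinberg_algebra_def)
  obtain H d where H: "finite H" "\<forall>U\<in>H. compact_open_bisection G U" "d \<in> H \<rightarrow> carrier R"
    and g: "g = (\<lambda>\<gamma>. \<Oplus>U\<in>H. d U \<otimes> char_fun R U \<gamma>)"
    using assms(2) by (auto simp: steinberg_algebra_def)
  \<comment> \<open>A representation attaches one coefficient to each bisection, and the two
    families may overlap. Both coefficient functions are therefore extended by zero to the union and
    added there.\<close>
  define c' where "c' = (\<lambda>U. if U \<in> F then c U else \<zero>)"
  define d' where "d' = (\<lambda>U. if U \<in> H then d U else \<zero>)"
  have cd: "c' U \<in> carrier R" "d' U \<in> carrier R" for U
    using F(3) H(3) by (auto simp: c'_def d'_def)
  have cd': "U \<in> F \<Longrightarrow> c U \<in> carrier R" "U \<in> H \<Longrightarrow> d U \<in> carrier R" for U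
    using F(3) H(3) by auto
  have "f \<gamma> \<oplus> g \<gamma> = (\<Oplus>U\<in>F \<union> H. (c' U \<oplus> d' U) \<otimes> char_fun R U \<gamma>)" for \<gamma>
  proof -
    have "f \<gamma> = (\<Oplus>U\<in>F \<union> H. c' U \<otimes> char_fun R U \<gamma>)"
      unfolding f by (rule add.finprod_mono_neutral_cong_left)
        (use F(1) H(1) cd' in \<open>auto simp: c'_def char_fun_closed\<close>)
    moreover have "g \<gamma> = (\<Oplus>U\<in>F \<union> H. d' U \<otimes> char_fun R U \<gamma>)"
      unfolding g by (rule add.finprod_mono_neutral_cong_left)
        (use F(1) H(1) cd' in \<open>auto simp: d'_def char_fun_closed\<close>)
    ultimately have "f \<gamma> \<oplus> g \<gamma> = (\<Oplus>U\<in>F \<union> H. c' U \<otimes> char_fun R U \<gamma> \<oplus> d' U \<otimes> char_fun R U \<gamma>)"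
      using cd by (simp add: finsum_addf char_fun_closed Pi_I)
    then show ?thesis using cd by (simp add: l_distr char_fun_closed)
  qed
  then show ?thesis
    using F H cd
    by (auto simp: steinberg_algebra_def intro!: exI[of _ "F \<union> H"] exI[of _ "\<lambda>U. c' U \<oplus> d' U"])
qed

lemma (in ring) steinberg_algebra_char_fun:
  assumes "compact_open_bisection G U" "c \<in> carrier R"
  shows "(\<lambda>\<gamma>. c \<otimes> char_fun R U \<gamma>) \<in> carrier (steinberg_algebra R G)"
proof -
  have "(\<Oplus>V\<in>{U}. c \<otimes> char_fun R V \<gamma>) = c \<otimes> char_fun R U \<gamma>" for \<gamma>
    using assms by (simp add: finsum_singleton char_fun_closed)
  then show ?thesis
    using assms by (auto simp: steinberg_algebra_def intro!: exI[of _ "{U}"] exI[of _ "\<lambda>_. c"])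
qed

lemma (in ring) steinberg_algebra_values:
  "f \<in> carrier (steinberg_algebra R G) \<Longrightarrow> f \<gamma> \<in> carrier R"
  by (induction rule: steinberg_algebra_induct) (auto simp: char_fun_closed)

lemma (in ring) steinberg_algebra_eq_zero:
  "f \<in> carrier (steinberg_algebra R G) \<Longrightarrow> \<gamma> \<notin> arrows G \<Longrightarrow> f \<gamma> = \<zero>"
proof (induction rule: steinberg_algebra_induct)
  case (add U c f)
  then have "\<gamma> \<notin> U" using openin_subset
    by (auto simp: compact_open_bisection_def bisection_def arrows_def)
  then show ?case using add by (simp add: char_fun_def)
qed simp

text \<open>Each bisection contributes at most one arrow with range \<open>v\<close>. This makes the
  sums in the action on sections finite, so that \<open>finsum\<close> has its intended
  value.\<close>

lemma (in ring) finite_support_rng_fibre: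
  assumes "f \<in> carrier (steinberg_algebra R G)"
  shows "finite {\<gamma> \<in> arrows G. rng G \<gamma> = v \<and> f \<gamma> \<noteq> \<zero>}"
  using assms
proof (induction rule: steinberg_algebra_induct)
  case (add U c f)
  have "finite {\<gamma> \<in> U. rng G \<gamma> = v}"
    using add.hyps(1) by (intro finite_inj_on_fibre) (auto simp: compact_open_bisection_def bisection_def)
  moreover have "{\<gamma> \<in> arrows G. rng G \<gamma> = v \<and> c \<otimes> char_fun R U \<gamma> \<oplus> f \<gamma> \<noteq> \<zero>}
      \<subseteq> {\<gamma> \<in> U. rng G \<gamma> = v} \<union> {\<gamma> \<in> arrows G. rng G \<gamma> = v \<and> f \<gamma> \<noteq> \<zero>}"
    using add.hyps(2) by (auto simp: char_fun_def)
  ultimately show ?case using add.IH by (meson finite_UnI finite_subset)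
qed simp

section \<open>Compact open bisections of a restricted groupoid\<close>

lemma arrows_restrict_groupoid: "arrows (restrict_groupoid G Y) = {\<gamma> \<in> arrows G. src G \<gamma> \<in> Y}"
  by (auto simp: arrows_def restrict_groupoid_def)

text \<open>Compactness and the Hausdorff property are intrinsic and can be tested in the ambient
  arrow space; only openness is relative.\<close>

lemma compact_open_bisection_restrict_groupoid:
  "compact_open_bisection (restrict_groupoid G Y) U \<longleftrightarrow>
     openin (subtopology (arrow_topology G) {\<gamma>. src G \<gamma> \<in> Y}) U \<and> inj_on (src G) U \<and>
     inj_on (rng G) U \<and> compact_hausdorff_in (arrow_topology G) U"
  using openin_subset[of "subtopology (arrow_topology G) {\<gamma>. src G \<gamma> \<in> Y}" U]
  by (auto simp: compact_open_bisection_def bisection_def restrict_groupoid_def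
      compact_hausdorff_in_subtopology)

text \<open>The arrows with source in the open set \<open>Y\<close> form an open set, so relatively
  open subsets of it are open.\<close>

lemma (in topological_groupoid) compact_open_bisection_restrict_open:
  assumes "openin (unit_space G) Y" "compact_open_bisection (restrict_groupoid G Y) U"
  shows "compact_open_bisection G U"
proof -
  have "openin (arrow_topology G) ({\<gamma> \<in> arrows G. src G \<gamma> \<in> Y} \<inter> W)"
    if "openin (arrow_topology G) W" for W
    using src_preimage_openin[OF assms(1)] that by (rule openin_Int)
  moreover have "{\<gamma> \<in> arrows G. src G \<gamma> \<in> Y} \<inter> W = W \<inter> {\<gamma>. src G \<gamma> \<in> Y}"
    if "openin (arrow_topology G) W" for W
    using openin_subset[OF that] by (auto simp: arrows_def)
  ultimately show ?thesis
    using assms(2)[unfolded compact_open_bisection_restrict_groupoid openin_subtopology]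
    by (auto simp: compact_open_bisection_def bisection_def)
qed

text \<open>Closedness of \<open>X\<close> keeps the trace compact. The second claim, for clopen
  \<open>X\<close>, allows the sources of a bisection of \<open>G\<close> to be cut down within
  \<open>G\<close>.\<close>

lemma (in topological_groupoid) compact_open_bisection_Int_src:
  assumes "closedin (unit_space G) X" "compact_open_bisection G U"
  shows "compact_open_bisection (restrict_groupoid G X) (U \<inter> {\<gamma> \<in> arrows G. src G \<gamma> \<in> X})"
    and "openin (unit_space G) X \<Longrightarrow> compact_open_bisection G (U \<inter> {\<gamma> \<in> arrows G. src G \<gamma> \<in> X})"
proof -
  let ?X = "{\<gamma> \<in> arrows G. src G \<gamma> \<in> X}"
  have U: "openin (arrow_topology G) U" "inj_on (src G) (U \<inter> ?X)" "inj_on (rng G) (U \<inter> ?X)"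
    using assms(2) by (auto simp: compact_open_bisection_def bisection_def inj_on_Int)
  have c: "compact_hausdorff_in (arrow_topology G) (U \<inter> ?X)"
    using assms src_preimage_closedin
    by (auto simp: compact_open_bisection_def intro: compact_hausdorff_in_closed_Int)
  have "U \<inter> ?X = U \<inter> {\<gamma>. src G \<gamma> \<in> X}"
    using openin_subset[OF U(1)] by (auto simp: arrows_def)
  then show "compact_open_bisection (restrict_groupoid G X) (U \<inter> ?X)"
    using U c by (auto simp: compact_open_bisection_restrict_groupoid openin_subtopology)
  show "compact_open_bisection G (U \<inter> ?X)" if "openin (unit_space G) X"
    using U c src_preimage_openin[OF that]
    by (auto simp: compact_open_bisection_def bisection_def openin_Int)
qed

text \<open>Extension by zero is the identity in this encoding, so the inclusion of the ideal
  attached to an open set of units is plain membership.\<close>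

lemma (in ring) steinberg_algebra_restrict_open:
  assumes "topological_groupoid G" "openin (unit_space G) Y"
    and "f \<in> carrier (steinberg_algebra R (restrict_groupoid G Y))"
  shows "f \<in> carrier (steinberg_algebra R G)"
  using assms(3)
proof (induction rule: steinberg_algebra_induct)
  case (add U c f)
  then show ?case
    using topological_groupoid.compact_open_bisection_restrict_open[OF assms(1,2)]
    by (intro steinberg_algebra_add steinberg_algebra_char_fun)
qed (rule steinberg_algebra_zero)

section \<open>The restriction map as a surjective homomorphism\<close>

lemma steinberg_quotient_apply:
  "steinberg_quotient K G X f \<gamma> = (if \<gamma> \<in> arrows G \<and> src G \<gamma> \<in> X then f \<gamma> else \<zero>\<^bsub>K\<^esub>)"
  by (simp add: steinberg_quotient_def arrows_restrict_groupoid)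

lemma (in ring) steinberg_quotient_zero: "steinberg_quotient R G X (\<lambda>_. \<zero>) = (\<lambda>_. \<zero>)"
  by (simp add: steinberg_quotient_def)

lemma (in ring) steinberg_quotient_add:
  "steinberg_quotient R G X (\<lambda>\<gamma>. f \<gamma> \<oplus> g \<gamma>) =
     (\<lambda>\<gamma>. steinberg_quotient R G X f \<gamma> \<oplus> steinberg_quotient R G X g \<gamma>)"
  by (auto simp: steinberg_quotient_def)

lemma (in ring) steinberg_quotient_char_fun:
  assumes "c \<in> carrier R"
  shows "steinberg_quotient R G X (\<lambda>\<gamma>. c \<otimes> char_fun R U \<gamma>) =
     (\<lambda>\<gamma>. c \<otimes> char_fun R (U \<inter> {\<gamma> \<in> arrows G. src G \<gamma> \<in> X}) \<gamma>)"
  using assms by (auto simp: steinberg_quotient_apply char_fun_def)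

lemma (in ring) steinberg_quotient_closed:
  assumes "topological_groupoid G" "closedin (unit_space G) X"
    and "f \<in> carrier (steinberg_algebra R G)"
  shows "steinberg_quotient R G X f \<in> carrier (steinberg_algebra R (restrict_groupoid G X))"
  using assms(3)
proof (induction rule: steinberg_algebra_induct)
  case zero
  then show ?case by (simp add: steinberg_quotient_zero steinberg_algebra_zero)
next
  case (add U c f)
  then show ?case
    using topological_groupoid.compact_open_bisection_Int_src(1)[OF assms(1,2)]
    by (auto simp: steinberg_quotient_add steinberg_quotient_char_fun
        intro!: steinberg_algebra_add steinberg_algebra_char_fun)
qed

text \<open>A compact open bisection of \<open>G|\<^sub>X\<close> need not be the trace of a bisection of \<open>G\<close>, but it is
  covered by finitely many bisections of \<open>G\<close>, which are made disjoint by cutting down their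
  sources; the difference of two compact open bisections need not be open when the arrow space
  is not Hausdorff.\<close>

lemma (in ring) char_fun_in_steinberg_quotient_image:
  assumes "ample_groupoid G" "closedin (unit_space G) X"
    and U: "compact_open_bisection (restrict_groupoid G X) U" and c: "c \<in> carrier R"
  shows "(\<lambda>\<gamma>. c \<otimes> char_fun R U \<gamma>) \<in> steinberg_quotient R G X ` carrier (steinberg_algebra R G)"
proof -
  interpret ample_groupoid G by fact
  let ?T = "arrow_topology G" and ?X = "{\<gamma> \<in> arrows G. src G \<gamma> \<in> X}"
  have inj: "inj_on (src G) U" and comp: "compactin ?T U"
    using U by (auto simp: compact_open_bisection_restrict_groupoid compact_hausdorff_in_def)
  obtain U' where U': "openin ?T U'" "U = U' \<inter> {\<gamma>. src G \<gamma> \<in> X}"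
    using U by (auto simp: compact_open_bisection_restrict_groupoid openin_subtopology)
  have UX: "U = U' \<inter> ?X" using U' openin_subset[OF U'(1)] by (auto simp: arrows_def)
  let ?\<B> = "{B. compact_open_bisection G B \<and> B \<subseteq> U'}"
  have "\<forall>B\<in>?\<B>. openin ?T B" by (auto simp: compact_open_bisection_def bisection_def)
  moreover have "U \<subseteq> \<Union>?\<B>"
  proof
    fix \<gamma> assume "\<gamma> \<in> U"
    then have "\<gamma> \<in> U'" using U'(2) by blast
    from compact_open_bisection_nhd[OF U'(1) this] show "\<gamma> \<in> \<Union>?\<B>" by blast
  qed
  ultimately obtain F where F: "finite F" "F \<subseteq> ?\<B>" "U \<subseteq> \<Union>F"
    using comp by (metis (no_types, lifting) compactin_def)
  have "(\<lambda>\<gamma>. c \<otimes> char_fun R (\<Union>F \<inter> ?X) \<gamma>) \<in> steinberg_quotient R G X ` carrier (steinberg_algebra R G)"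
    using F(1,2)
  proof (induction F rule: finite_induct)
    case empty
    have "(\<lambda>\<gamma>. c \<otimes> char_fun R (\<Union>{} \<inter> ?X) \<gamma>) = steinberg_quotient R G X (\<lambda>_. \<zero>)"
      using c by (simp add: char_fun_def steinberg_quotient_zero)
    then show ?case using steinberg_algebra_zero by (rule image_eqI)
  next
    case (insert B F)
    then obtain f where f: "f \<in> carrier (steinberg_algebra R G)"
      "(\<lambda>\<gamma>. c \<otimes> char_fun R (\<Union>F \<inter> ?X) \<gamma>) = steinberg_quotient R G X f" by blast
    let ?W = "unit_set G - src G ` \<Union>F"
    have "openin ?T (\<Union>F)" "compactin ?T (\<Union>F)"
      using insert by (auto simp: compact_open_bisection_def bisection_def compact_hausdorff_in_def
          intro!: compactin_Union)
    \<comment> \<open>The set of sources already used is open because the source map is open, and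
      closed because it is compact in a Hausdorff space. Its complement \<open>?W\<close> is thus
      clopen.\<close>
    then have "openin (unit_space G) (src G ` \<Union>F)" "closedin (unit_space G) (src G ` \<Union>F)"
      using image_compactin[OF _ continuous_src] units_Hausdorff
      by (auto intro: local_homeomorphism_open_image[OF src_local_homeo] compactin_imp_closedin)
    then have W: "closedin (unit_space G) ?W" "openin (unit_space G) ?W"
      using topspace_unit_space by (metis closedin_def openin_closedin_eq openin_diff closedin_diff openin_topspace closedin_topspace)+
    define B' where "B' = B \<inter> {\<gamma> \<in> arrows G. src G \<gamma> \<in> ?W}"
    have B': "compact_open_bisection G B'"
      unfolding B'_def using insert.prems W by (intro compact_open_bisection_Int_src) auto
    let ?g = "\<lambda>\<gamma>. c \<otimes> char_fun R B' \<gamma>"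
    have BU: "B \<subseteq> U'" "\<Union>F \<subseteq> U'" using insert.prems by auto
    have disj: "B' \<inter> \<Union>F = {}" by (auto simp: B'_def)
    \<comment> \<open>Nothing is lost over \<open>X\<close>: an arrow cut away from \<open>B\<close>
      shares its source with an arrow of \<open>\<Union>F\<close>. If that source lies in
      \<open>X\<close>, both arrows belong to \<open>U\<close>, where the source map is injective,
      so they coincide.\<close>
    have cover: "\<gamma> \<in> \<Union>F" if "\<gamma> \<in> B" "\<gamma> \<in> ?X" "\<gamma> \<notin> B'" for \<gamma>
    proof -
      have "src G \<gamma> \<in> src G ` \<Union>F" using that src_in_units by (auto simp: B'_def)
      then obtain \<delta> where \<delta>: "\<delta> \<in> \<Union>F" "src G \<gamma> = src G \<delta>" by blast
      then have "\<delta> \<in> U" "\<gamma> \<in> U" using that BU U'(2) by auto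
      then have "\<gamma> = \<delta>" using \<delta>(2) inj by (auto dest: inj_onD)
      then show ?thesis using \<delta>(1) by simp
    qed
    have "char_fun R (\<Union>(insert B F) \<inter> ?X) \<gamma> = char_fun R (B' \<inter> ?X) \<gamma> \<oplus> char_fun R (\<Union>F \<inter> ?X) \<gamma>" for \<gamma>
      using disj cover[of \<gamma>] by (auto simp: char_fun_def B'_def)
    then have "(\<lambda>\<gamma>. c \<otimes> char_fun R (\<Union>(insert B F) \<inter> ?X) \<gamma>) =
        (\<lambda>\<gamma>. steinberg_quotient R G X ?g \<gamma> \<oplus> steinberg_quotient R G X f \<gamma>)"
      unfolding f(2)[symmetric] steinberg_quotient_char_fun[OF c]
      using c by (simp add: r_distr char_fun_closed)
    also have "\<dots> = steinberg_quotient R G X (\<lambda>\<gamma>. ?g \<gamma> \<oplus> f \<gamma>)"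
      by (simp add: steinberg_quotient_add)
    finally show ?case
      using steinberg_algebra_add[OF steinberg_algebra_char_fun[OF B' c] f(1)] by (rule image_eqI)
  qed
  moreover have "\<Union>F \<inter> ?X = U" using F(2,3) UX by auto
  ultimately show ?thesis by simp
qed

text \<open>Surjectivity follows by induction on the target algebra: the map is additive and every
  multiple of a characteristic function of a bisection over \<open>X\<close> has a preimage.\<close>

lemma (in ring) steinberg_quotient_image:
  assumes "ample_groupoid G" "closedin (unit_space G) X"
  shows "steinberg_quotient R G X ` carrier (steinberg_algebra R G) =
    carrier (steinberg_algebra R (restrict_groupoid G X))"
proof (intro equalityI subsetI)
  interpret ample_groupoid G by fact
  fix g assume "g \<in> steinberg_quotient R G X ` carrier (steinberg_algebra R G)"
  then show "g \<in> carrier (steinberg_algebra R (restrict_groupoid G X))"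
    using steinberg_quotient_closed[OF topological_groupoid_axioms assms(2)] by blast
next
  fix g assume "g \<in> carrier (steinberg_algebra R (restrict_groupoid G X))"
  then show "g \<in> steinberg_quotient R G X ` carrier (steinberg_algebra R G)"
  proof (induction rule: steinberg_algebra_induct)
    case zero
    show ?case using steinberg_quotient_zero[symmetric] steinberg_algebra_zero by (rule image_eqI)
  next
    case (add U c g)
    obtain f where f: "f \<in> carrier (steinberg_algebra R G)" "g = steinberg_quotient R G X f"
      using add.IH by blast
    obtain h where h: "h \<in> carrier (steinberg_algebra R G)"
      "(\<lambda>\<gamma>. c \<otimes> char_fun R U \<gamma>) = steinberg_quotient R G X h"
      using char_fun_in_steinberg_quotient_image[OF assms add.hyps(1,2)] by blast
    have "(\<lambda>\<gamma>. c \<otimes> char_fun R U \<gamma> \<oplus> g \<gamma>) = steinberg_quotient R G X (\<lambda>\<gamma>. h \<gamma> \<oplus> f \<gamma>)"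
      using fun_cong[OF h(2)] by (simp add: f(2) steinberg_quotient_add)
    then show ?case using steinberg_algebra_add[OF h(1) f(1)] by (rule image_eqI)
  qed
qed

text \<open>For \<open>\<gamma>\<close> with source in \<open>X\<close>, every
  \<open>\<alpha>\<close> in the convolution sum has the same source. The factor
  \<open>comp G \<gamma> (ginv G \<alpha>)\<close> has the range of \<open>\<alpha>\<close> as its
  source, which lies in \<open>X\<close> by invariance. So restriction changes no term of the
  sum.\<close>

lemma (in ring) steinberg_quotient_mult:
  assumes "topological_groupoid G"
    and inv: "\<And>\<gamma>. \<gamma> \<in> arrows G \<Longrightarrow> src G \<gamma> \<in> X \<Longrightarrow> rng G \<gamma> \<in> X"
    and f: "f \<in> carrier (steinberg_algebra R G)" and g: "g \<in> carrier (steinberg_algebra R G)"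
  shows "steinberg_quotient R G X (f \<otimes>\<^bsub>steinberg_algebra R G\<^esub> g) =
    steinberg_quotient R G X f \<otimes>\<^bsub>steinberg_algebra R (restrict_groupoid G X)\<^esub> steinberg_quotient R G X g"
proof
  interpret topological_groupoid G by fact
  fix \<gamma>
  let ?q = "steinberg_quotient R G X" and ?GX = "restrict_groupoid G X"
  have [simp]: "src ?GX = src G" "comp ?GX = comp G" "ginv ?GX = ginv G"
    by (simp_all add: restrict_groupoid_def)
  show "?q (f \<otimes>\<^bsub>steinberg_algebra R G\<^esub> g) \<gamma> = (?q f \<otimes>\<^bsub>steinberg_algebra R ?GX\<^esub> ?q g) \<gamma>"
  proof (cases "\<gamma> \<in> arrows ?GX")
    case True
    then have \<gamma>: "\<gamma> \<in> arrows G" "src G \<gamma> \<in> X" by (auto simp: arrows_restrict_groupoid)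
    have "(\<Oplus>\<alpha>\<in>{\<alpha> \<in> arrows G. src G \<alpha> = src G \<gamma> \<and> g \<alpha> \<noteq> \<zero>}. f (comp G \<gamma> (ginv G \<alpha>)) \<otimes> g \<alpha>) =
      (\<Oplus>\<alpha>\<in>{\<alpha> \<in> arrows ?GX. src G \<alpha> = src G \<gamma> \<and> ?q g \<alpha> \<noteq> \<zero>}. ?q f (comp G \<gamma> (ginv G \<alpha>)) \<otimes> ?q g \<alpha>)"
    proof (rule finsum_cong')
      show "{\<alpha> \<in> arrows G. src G \<alpha> = src G \<gamma> \<and> g \<alpha> \<noteq> \<zero>} = {\<alpha> \<in> arrows ?GX. src G \<alpha> = src G \<gamma> \<and> ?q g \<alpha> \<noteq> \<zero>}"
        using \<gamma> by (auto simp: arrows_restrict_groupoid steinberg_quotient_apply)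
      show "(\<lambda>\<alpha>. ?q f (comp G \<gamma> (ginv G \<alpha>)) \<otimes> ?q g \<alpha>) \<in>
          {\<alpha> \<in> arrows ?GX. src G \<alpha> = src G \<gamma> \<and> ?q g \<alpha> \<noteq> \<zero>} \<rightarrow> carrier R"
        using steinberg_algebra_values[OF f] steinberg_algebra_values[OF g]
        by (auto simp: steinberg_quotient_apply)
      fix \<alpha> assume "\<alpha> \<in> {\<alpha> \<in> arrows ?GX. src G \<alpha> = src G \<gamma> \<and> ?q g \<alpha> \<noteq> \<zero>}"
      then have \<alpha>: "\<alpha> \<in> arrows G" "src G \<alpha> = src G \<gamma>" by (auto simp: arrows_restrict_groupoid)
      then have "comp G \<gamma> (ginv G \<alpha>) \<in> arrows G" "src G (comp G \<gamma> (ginv G \<alpha>)) \<in> X"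
        using \<gamma> inv by (auto simp: comp_closed ginv_closed rng_ginv src_ginv src_comp)
      then show "f (comp G \<gamma> (ginv G \<alpha>)) \<otimes> g \<alpha> = ?q f (comp G \<gamma> (ginv G \<alpha>)) \<otimes> ?q g \<alpha>"
        using \<alpha> \<gamma> by (simp add: steinberg_quotient_apply)
    qed
    then show ?thesis using True \<gamma> by (simp add: steinberg_algebra_def steinberg_quotient_apply)
  next
    case False
    then show ?thesis by (auto simp: steinberg_algebra_def steinberg_quotient_apply arrows_restrict_groupoid)
  qed
qed


section \<open>Compactly supported sections\<close>

locale ample_gsheaf = gsheaf_vector_spaces K G E + ample_groupoid G + K: ring K
  for K :: "('k, 'z) ring_scheme" and G :: "'a groupoid" and E :: "('a, 'k, 'e) gsheaf"
begin

abbreviation "\<Gamma> \<equiv> compact_sections K G E"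

section \<open>Stalks, the action on them, and the support\<close>

lemma stalk_simps:
  "e \<in> carrier (stalk E u) \<longleftrightarrow> e \<in> topspace (total_space E) \<and> proj E e = u"
  "zero (stalk E u) = zero_section E u" "add (stalk E u) = fib_add E"
  "smult (stalk E u) = fib_scale E"
  by (simp_all add: stalk_def)

lemma
  assumes "u \<in> unit_set G"
  shows zero_section_stalk: "zero_section E u \<in> carrier (stalk E u)"
    and fib_scale_stalk:
      "c \<in> carrier K \<Longrightarrow> e \<in> carrier (stalk E u) \<Longrightarrow> fib_scale E c e \<in> carrier (stalk E u)"
    and fib_scale_zero_section: "c \<in> carrier K \<Longrightarrow> fib_scale E c (zero_section E u) = zero_section E u"
    and fib_scale_zero:
      "e \<in> carrier (stalk E u) \<Longrightarrow> fib_scale E \<zero>\<^bsub>K\<^esub> e = zero_section E u"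
    and fib_add_zero_right: "e \<in> carrier (stalk E u) \<Longrightarrow> fib_add E e (zero_section E u) = e"
proof -
  interpret S: module K "stalk E u" using stalk_vector_space assms .
  note [simp] = stalk_simps(2-4)
  show "zero_section E u \<in> carrier (stalk E u)" using S.M.zero_closed by simp
  show "c \<in> carrier K \<Longrightarrow> e \<in> carrier (stalk E u) \<Longrightarrow> fib_scale E c e \<in> carrier (stalk E u)"
    using S.smult_closed[of c e] by simp
  show "c \<in> carrier K \<Longrightarrow> fib_scale E c (zero_section E u) = zero_section E u"
    using S.smult_r_null[of c] by simp
  show "e \<in> carrier (stalk E u) \<Longrightarrow> fib_scale E \<zero>\<^bsub>K\<^esub> e = zero_section E u"
    using S.smult_l_null[of e] by simp
  show "e \<in> carrier (stalk E u) \<Longrightarrow> fib_add E e (zero_section E u) = e"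
    using S.M.r_zero[of e] by simp
qed

lemma action_stalk:
  assumes "\<gamma> \<in> arrows G" "e \<in> carrier (stalk E (src G \<gamma>))"
  shows "action E \<gamma> e \<in> carrier (stalk E (rng G \<gamma>))"
proof -
  have "(\<gamma>, e) \<in> topspace (subtopology (prod_topology (arrow_topology G) (total_space E))
      {(\<gamma>, e). src G \<gamma> = proj E e})"
    using assms by (simp add: arrows_def stalk_simps)
  then have "(\<lambda>(\<gamma>, e). action E \<gamma> e) (\<gamma>, e) \<in> topspace (total_space E)"
    using continuous_map_image_subset_topspace[OF continuous_action] by blast
  then show ?thesis
    using assms proj_action by (simp add: stalk_simps)
qed

text \<open>The zero of a stalk is a multiple by the scalar zero, and the action commutes with
  scalars.\<close>

lemma action_zero_section:
  assumes "\<gamma> \<in> arrows G"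
  shows "action E \<gamma> (zero_section E (src G \<gamma>)) = zero_section E (rng G \<gamma>)"
proof -
  note u = src_in_units[OF assms] rng_in_units[OF assms]
  note z = zero_section_stalk[OF u(1)]
  have "action E \<gamma> (fib_scale E \<zero>\<^bsub>K\<^esub> (zero_section E (src G \<gamma>))) =
      fib_scale E \<zero>\<^bsub>K\<^esub> (action E \<gamma> (zero_section E (src G \<gamma>)))"
    using action_scale[OF assms K.zero_closed z] .
  then show ?thesis
    using fib_scale_zero[OF u(1) z] fib_scale_zero[OF u(2) action_stalk[OF assms z]] by simp
qed

lemma stalk_eq_zero:
  "u \<in> unit_set G \<Longrightarrow> u \<notin> sheaf_support G E \<Longrightarrow> e \<in> carrier (stalk E u) \<Longrightarrow> e = zero_section E u"
  by (auto simp: sheaf_support_def)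

text \<open>An arrow maps the stalk at its source injectively, the inverse arrow undoing it; a zero
  stalk at the range would force a zero stalk at the source.\<close>

lemma rng_in_support:
  assumes "\<gamma> \<in> arrows G" "src G \<gamma> \<in> sheaf_support G E"
  shows "rng G \<gamma> \<in> sheaf_support G E"
proof (rule ccontr)
  assume r: "rng G \<gamma> \<notin> sheaf_support G E"
  note u = src_in_units[OF assms(1)] rng_in_units[OF assms(1)]
  have "e = zero_section E (src G \<gamma>)" if e: "e \<in> carrier (stalk E (src G \<gamma>))" for e
  proof -
    have "action E \<gamma> e = zero_section E (rng G \<gamma>)"
      using stalk_eq_zero[OF u(2) r action_stalk[OF assms(1) e]] .
    then have "action E (ginv G \<gamma>) (action E \<gamma> e) = zero_section E (src G \<gamma>)"
      using action_zero_section[OF ginv_closed[OF assms(1)]] by (simp add: src_ginv rng_ginv assms(1))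
    moreover have "action E (ginv G \<gamma>) (action E \<gamma> e) = action E (comp G (ginv G \<gamma>) \<gamma>) e"
      using e by (intro action_comp) (auto simp: stalk_simps assms(1) ginv_closed src_ginv)
    moreover have "\<dots> = e"
      using e action_unit[of e] by (simp add: ginv_comp assms(1) stalk_simps)
    ultimately show ?thesis by simp
  qed
  then have "carrier (stalk E (src G \<gamma>)) = {zero_section E (src G \<gamma>)}"
    using zero_section_stalk[OF u(1)] by blast
  then show False using assms(2) by (simp add: sheaf_support_def)
qed

section \<open>The module of sections, evaluated pointwise\<close>

lemma section_stalk: "t \<in> carrier \<Gamma> \<Longrightarrow> u \<in> unit_set G \<Longrightarrow> t u \<in> carrier (stalk E u)"
  using continuous_map_image_subset_topspace[of "unit_space G" "total_space E" t]
  by (auto simp: compact_sections_def stalk_simps topspace_unit_space)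

lemma section_zero_eq: "u \<in> unit_set G \<Longrightarrow> \<zero>\<^bsub>\<Gamma>\<^esub> u = zero_section E u"
  by (simp add: compact_sections_def)

lemma section_add_eq: "u \<in> unit_set G \<Longrightarrow> (t \<oplus>\<^bsub>\<Gamma>\<^esub> t') u = fib_add E (t u) (t' u)"
  by (simp add: compact_sections_def)

lemma section_smult_eq:
  "v \<in> unit_set G \<Longrightarrow> (f \<odot>\<^bsub>\<Gamma>\<^esub> t) v =
     (\<Oplus>\<^bsub>stalk E v\<^esub>\<gamma>\<in>{\<gamma> \<in> arrows G. rng G \<gamma> = v \<and> f \<gamma> \<noteq> \<zero>\<^bsub>K\<^esub>}.
        fib_scale E (f \<gamma>) (action E \<gamma> (t (src G \<gamma>))))"
  by (simp add: compact_sections_def)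

lemma section_smult_term_zero:
  assumes "\<gamma> \<in> arrows G" "f \<gamma> \<in> carrier K" "t (src G \<gamma>) = zero_section E (src G \<gamma>)"
  shows "fib_scale E (f \<gamma>) (action E \<gamma> (t (src G \<gamma>))) = zero_section E (rng G \<gamma>)"
  using assms by (simp add: action_zero_section fib_scale_zero_section rng_in_units)

text \<open>All terms of the sum vanish. This serves both for sections vanishing on a set of units
  and for functions supported over the complement of \<open>X\<close>.\<close>

lemma section_smult_zero:
  assumes "v \<in> unit_set G" "\<And>\<gamma>. f \<gamma> \<in> carrier K"
    and "\<And>\<gamma>. \<gamma> \<in> arrows G \<Longrightarrow> rng G \<gamma> = v \<Longrightarrow> f \<gamma> \<noteq> \<zero>\<^bsub>K\<^esub> \<Longrightarrow>
      t (src G \<gamma>) = zero_section E (src G \<gamma>)"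
  shows "(f \<odot>\<^bsub>\<Gamma>\<^esub> t) v = zero_section E v"
proof -
  interpret S: module K "stalk E v" using stalk_vector_space assms(1) .
  show ?thesis
    unfolding section_smult_eq[OF assms(1)] stalk_simps(2)[symmetric]
    by (rule S.M.add.finprod_one_eqI) (use assms in \<open>auto simp: stalk_simps section_smult_term_zero\<close>)
qed

text \<open>Restricting \<open>f\<close> only discards arrows whose source lies outside
  \<open>X\<close>, and there \<open>t\<close> is zero. Both sides use the action formula over
  \<open>G\<close>, the restricted function being read as extended by zero.\<close>

lemma section_smult_quotient:
  assumes "f \<in> carrier (steinberg_algebra K G)" "t \<in> carrier \<Gamma>"
    and X: "\<And>u. u \<in> unit_set G \<Longrightarrow> u \<notin> X \<Longrightarrow> t u = zero_section E u"
  shows "steinberg_quotient K G X f \<odot>\<^bsub>\<Gamma>\<^esub> t = f \<odot>\<^bsub>\<Gamma>\<^esub> t"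
proof
  fix v
  note f = K.steinberg_algebra_values[OF assms(1)]
  show "(steinberg_quotient K G X f \<odot>\<^bsub>\<Gamma>\<^esub> t) v = (f \<odot>\<^bsub>\<Gamma>\<^esub> t) v"
  proof (cases "v \<in> unit_set G")
    case True
    interpret S: module K "stalk E v" using stalk_vector_space True .
    show ?thesis
      unfolding section_smult_eq[OF True]
    proof (rule S.M.add.finprod_mono_neutral_cong_left)
      show "finite {\<gamma> \<in> arrows G. rng G \<gamma> = v \<and> f \<gamma> \<noteq> \<zero>\<^bsub>K\<^esub>}"
        by (rule K.finite_support_rng_fibre[OF assms(1)])
      show "{\<gamma> \<in> arrows G. rng G \<gamma> = v \<and> steinberg_quotient K G X f \<gamma> \<noteq> \<zero>\<^bsub>K\<^esub>}
          \<subseteq> {\<gamma> \<in> arrows G. rng G \<gamma> = v \<and> f \<gamma> \<noteq> \<zero>\<^bsub>K\<^esub>}"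
        by (auto simp: steinberg_quotient_apply)
      show "(\<lambda>\<gamma>. fib_scale E (f \<gamma>) (action E \<gamma> (t (src G \<gamma>)))) \<in>
          {\<gamma> \<in> arrows G. rng G \<gamma> = v \<and> f \<gamma> \<noteq> \<zero>\<^bsub>K\<^esub>} \<rightarrow> carrier (stalk E v)"
      proof (rule Pi_I)
        fix \<gamma> assume "\<gamma> \<in> {\<gamma> \<in> arrows G. rng G \<gamma> = v \<and> f \<gamma> \<noteq> \<zero>\<^bsub>K\<^esub>}"
        then have \<gamma>: "\<gamma> \<in> arrows G" "rng G \<gamma> = v" by auto
        have "action E \<gamma> (t (src G \<gamma>)) \<in> carrier (stalk E v)"
          using action_stalk[OF \<gamma>(1) section_stalk[OF assms(2) src_in_units[OF \<gamma>(1)]]] \<gamma>(2) by simp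
        then show "fib_scale E (f \<gamma>) (action E \<gamma> (t (src G \<gamma>))) \<in> carrier (stalk E v)"
          by (rule fib_scale_stalk[OF True f])
      qed
      fix \<gamma> assume \<gamma>: "\<gamma> \<in> {\<gamma> \<in> arrows G. rng G \<gamma> = v \<and> f \<gamma> \<noteq> \<zero>\<^bsub>K\<^esub>} -
        {\<gamma> \<in> arrows G. rng G \<gamma> = v \<and> steinberg_quotient K G X f \<gamma> \<noteq> \<zero>\<^bsub>K\<^esub>}"
      then have "t (src G \<gamma>) = zero_section E (src G \<gamma>)"
        using X src_in_units by (auto simp: steinberg_quotient_apply split: if_splits)
      then show "fib_scale E (f \<gamma>) (action E \<gamma> (t (src G \<gamma>))) = \<zero>\<^bsub>stalk E v\<^esub>"
        using section_smult_term_zero[of \<gamma> f t] \<gamma> f by (simp add: stalk_simps)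
    next
      fix \<gamma> assume "\<gamma> \<in> {\<gamma> \<in> arrows G. rng G \<gamma> = v \<and> steinberg_quotient K G X f \<gamma> \<noteq> \<zero>\<^bsub>K\<^esub>}"
      then show "fib_scale E (steinberg_quotient K G X f \<gamma>) (action E \<gamma> (t (src G \<gamma>))) =
          fib_scale E (f \<gamma>) (action E \<gamma> (t (src G \<gamma>)))"
        by (auto simp: steinberg_quotient_apply split: if_splits)
    qed
  qed (simp add: compact_sections_def)
qed

text \<open>A local inverse of the projection through \<open>e\<close> is kept on a compact open set
  \<open>W\<close> around \<open>u\<close> inside \<open>V\<close> and replaced by zero elsewhere.
  Since \<open>W\<close> is clopen in the Hausdorff unit space, the result is continuous.\<close>

lemma section_through_point:
  assumes V: "openin (unit_space G) V" "u \<in> V" and e: "e \<in> carrier (stalk E u)"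
  obtains t where "t \<in> carrier \<Gamma>" "t u = e" "\<And>v. v \<in> unit_set G \<Longrightarrow> v \<notin> V \<Longrightarrow> t v = zero_section E v"
proof -
  let ?T = "unit_space G"
  have "e \<in> topspace (total_space E)" and pe: "proj E e = u" using e by (simp_all add: stalk_simps)
  obtain U g where "openin (total_space E) U" and U: "e \<in> U" "U \<subseteq> topspace (total_space E)"
    "openin ?T (proj E ` U)" "inj_on (proj E) U" "continuous_map (subtopology ?T (proj E ` U)) (total_space E) g"
    "\<forall>y\<in>U. g (proj E y) = y"
    by (rule local_homeomorphism_openE[OF proj_local_homeo openin_topspace \<open>e \<in> topspace (total_space E)\<close>])
  have "openin ?T (V \<inter> proj E ` U)" "u \<in> V \<inter> proj E ` U" using V U(1,3) pe by auto
  then obtain W where W: "openin ?T W" "compact_hausdorff_in ?T W" "u \<in> W" "W \<subseteq> V \<inter> proj E ` U"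
    by (rule compact_open_nhd)
  have W_sub: "W \<subseteq> unit_set G" using openin_subset[OF W(1)] by (simp add: topspace_unit_space)
  have closedW: "closedin ?T W"
    using W(2) units_Hausdorff by (simp add: compact_hausdorff_in_def compactin_imp_closedin)
  define t where "t = (\<lambda>v\<in>unit_set G. if v \<in> W then g v else zero_section E v)"
  \<comment> \<open>The two pieces, over \<open>W\<close> and over its open complement, are indexed
    by the booleans and pasted together.\<close>
  have cont: "continuous_map ?T (total_space E) t"
  proof (rule pasting_lemma[where I = UNIV and T = "\<lambda>b. if b then W else unit_set G - W"
        and f = "\<lambda>b. if b then g else zero_section E"])
    fix b :: bool
    show "openin ?T (if b then W else unit_set G - W)"
      using W(1) openin_diff[OF openin_topspace closedW] by (simp add: topspace_unit_space)
    have "continuous_map (subtopology ?T W) (total_space E) g"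
      using U(5) W(4) by (auto intro: continuous_map_from_subtopology_mono)
    then show "continuous_map (subtopology ?T (if b then W else unit_set G - W)) (total_space E)
        (if b then g else zero_section E)"
      by (simp add: continuous_map_from_subtopology[OF continuous_zero_section])
  next
    fix x assume "x \<in> topspace ?T"
    then show "\<exists>b. b \<in> UNIV \<and> x \<in> (if b then W else unit_set G - W) \<and>
        t x = (if b then g else zero_section E) x"
      by (auto simp: t_def topspace_unit_space intro!: exI[of _ "x \<in> W"])
  qed (auto split: if_splits)
  have proj_t: "proj E (t v) = v" if "v \<in> unit_set G" for v
  proof (cases "v \<in> W")
    case True
    then obtain y where "y \<in> U" "v = proj E y" using W(4) by blast
    then show ?thesis using True that U(6) by (simp add: t_def)
  next
    case False
    then show ?thesis using that zero_section_stalk by (simp add: t_def stalk_simps)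
  qed
  \<comment> \<open>The local inverse may take the value zero inside \<open>W\<close>, so the
    support can be smaller than \<open>W\<close>. The set of zeros is open, which makes the support
    a closed subset of the compact set \<open>W\<close>.\<close>
  let ?Z = "{v \<in> topspace ?T. t v = zero_section E v}"
  have "openin ?T ?Z"
  proof (rule openin_sections_agree[OF proj_local_homeo cont continuous_zero_section])
    fix v assume "v \<in> topspace ?T"
    then show "proj E (t v) = proj E (zero_section E v)"
      using proj_t zero_section_stalk by (simp add: stalk_simps topspace_unit_space)
  qed
  then have "compact_hausdorff_in ?T (W \<inter> (topspace ?T - ?Z))"
    using W(2) by (intro compact_hausdorff_in_closed_Int) auto
  also have "W \<inter> (topspace ?T - ?Z) = {v \<in> unit_set G. t v \<noteq> zero_section E v}"
    using W_sub by (auto simp: t_def topspace_unit_space)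
  finally have "t \<in> carrier \<Gamma>"
    using cont proj_t by (auto simp: compact_sections_def t_def)
  moreover have "t u = e" using U(1,6) W(3) W_sub pe by (auto simp: t_def)
  moreover have "t v = zero_section E v" if "v \<in> unit_set G" "v \<notin> V" for v
    using that W(4) by (auto simp: t_def)
  ultimately show thesis by (rule that)
qed

text \<open>At a unit of \<open>Y\<close>, the product of \<open>f\<close> and \<open>t\<close>
  involves only values of \<open>t\<close> at sources of arrows with range in \<open>Y\<close>, and
  these sources lie in \<open>Y\<close> again.\<close>

lemma submodule_vanishing_sections:
  assumes "nonunital_module (steinberg_algebra K G) \<Gamma>" and Y: "Y \<subseteq> unit_set G"
    and inv: "\<And>\<gamma>. \<gamma> \<in> arrows G \<Longrightarrow> rng G \<gamma> \<in> Y \<Longrightarrow> src G \<gamma> \<in> Y"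
  shows "submodule {t \<in> carrier \<Gamma>. \<forall>u\<in>Y. t u = zero_section E u} (steinberg_algebra K G) \<Gamma>"
    (is "submodule ?N _ _")
proof -
  interpret nonunital_module "steinberg_algebra K G" \<Gamma> by fact
  have zero_add: "fib_add E (zero_section E u) (zero_section E u) = zero_section E u"
    if "u \<in> Y" for u
    using that Y fib_add_zero_right zero_section_stalk by blast
  show ?thesis
  proof (intro submodule.intro submodule_axioms.intro subgroup.intro, goal_cases)
    case 1
    show ?case by auto
  next
    case (2 t t')
    then show ?case using Y zero_add M.a_closed by (auto simp: section_add_eq subset_iff)
  next
    case 3
    then show ?case using Y M.zero_closed by (auto simp: section_zero_eq subset_iff)
  next
    \<comment> \<open>The additive inverse of a section has no pointwise formula in the definition.
      Its value is read off from the sum of \<open>t\<close> and its inverse being zero, in which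
      the summand \<open>t u\<close> is zero.\<close>
    case (4 t)
    then have t: "t \<in> carrier \<Gamma>" by simp
    have "(\<ominus>\<^bsub>\<Gamma>\<^esub> t) u = zero_section E u" if u: "u \<in> Y" for u
    proof -
      have uG: "u \<in> unit_set G" using u Y by blast
      have "fib_add E ((\<ominus>\<^bsub>\<Gamma>\<^esub> t) u) (t u) = zero_section E u"
        using section_add_eq[OF uG, of "\<ominus>\<^bsub>\<Gamma>\<^esub> t" t] section_zero_eq[OF uG] M.l_neg[OF t] by simp
      then show ?thesis
        using 4 u fib_add_zero_right[OF uG section_stalk[OF M.a_inv_closed[OF t] uG]] by simp
    qed
    then show ?case using M.a_inv_closed[OF t] by (simp add: a_inv_def)
  next
    case (5 f t)
    have "(f \<odot>\<^bsub>\<Gamma>\<^esub> t) u = zero_section E u" if "u \<in> Y" for u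
      using 5 that Y inv K.steinberg_algebra_values[of f G] by (intro section_smult_zero) auto
    then show ?case using 5 act_closed by simp
  qed
qed

text \<open>The support is closed under arrows and so contains the orbit, which gives one inclusion
  of closures. The other one follows once the support is shown to lie in the closure of the orbit,
  and this is where simplicity enters.\<close>

lemma closure_of_orbit:
  assumes "simple_module (steinberg_algebra K G) \<Gamma>" and u: "u \<in> sheaf_support G E"
  shows "unit_space G closure_of orbit G u = unit_space G closure_of sheaf_support G E"
proof -
  interpret simple_module "steinberg_algebra K G" \<Gamma> by fact
  let ?T = "unit_space G" and ?O = "orbit G u"
  have uG: "u \<in> unit_set G" using u by (simp add: sheaf_support_def)
  have O: "?O \<subseteq> unit_set G" "?O \<subseteq> sheaf_support G E"
    using rng_in_support u by (auto simp: orbit_def)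
  let ?N = "{t \<in> carrier \<Gamma>. \<forall>v\<in>?O. t v = zero_section E v}"
  \<comment> \<open>An orbit contains the source of every arrow whose range it contains, by
    inverting the arrow.\<close>
  have sub: "submodule ?N (steinberg_algebra K G) \<Gamma>"
    by (rule submodule_vanishing_sections[OF nonunital_module_axioms O(1)])
      (use src_in_orbit orbit_trans in blast)
  obtain e where e: "e \<in> carrier (stalk E u)" "e \<noteq> zero_section E u"
    using u zero_section_stalk[OF uG] by (auto simp: sheaf_support_def)
  obtain t where "t \<in> carrier \<Gamma>" "t u = e"
    by (rule section_through_point[OF openin_topspace _ e(1)]) (use uG in \<open>auto simp: topspace_unit_space\<close>)
  then have "?N \<noteq> carrier \<Gamma>" using e(2) orbit_refl[OF uG] by blast
  then have N: "?N = {\<zero>\<^bsub>\<Gamma>\<^esub>}" using only_trivial_submodules[OF sub] by blast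
  have "sheaf_support G E \<subseteq> ?T closure_of ?O"
  proof (rule ccontr)
    assume "\<not> ?thesis"
    then obtain w where w: "w \<in> sheaf_support G E" "w \<notin> ?T closure_of ?O" by blast
    have wG: "w \<in> unit_set G" using w by (simp add: sheaf_support_def)
    obtain d where d: "d \<in> carrier (stalk E w)" "d \<noteq> zero_section E w"
      using w zero_section_stalk[OF wG] by (auto simp: sheaf_support_def)
    let ?V = "topspace ?T - ?T closure_of ?O"
    have "openin ?T ?V" by (intro openin_diff) auto
    moreover have "w \<in> ?V" using w(2) wG by (simp add: topspace_unit_space)
    ultimately obtain t where t: "t \<in> carrier \<Gamma>" "t w = d"
      "\<And>v. v \<in> unit_set G \<Longrightarrow> v \<notin> ?V \<Longrightarrow> t v = zero_section E v"
      using section_through_point[OF _ _ d(1)] by blast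
    \<comment> \<open>The orbit is disjoint from \<open>?V\<close>, so \<open>t\<close> vanishes on
      it and must be zero, against its value \<open>d\<close> at \<open>w\<close>.\<close>
    have "?O \<subseteq> ?T closure_of ?O" using O(1) by (simp add: closure_of_subset topspace_unit_space)
    then have "t \<in> ?N" using t(1,3) O(1) by auto
    then have "t = \<zero>\<^bsub>\<Gamma>\<^esub>" using N by blast
    then show False using t(2) d(2) section_zero_eq[OF wG] by simp
  qed
  then have "?T closure_of sheaf_support G E \<subseteq> ?T closure_of ?O"
    by (simp add: closure_of_minimal)
  then show ?thesis using closure_of_mono[OF O(2)] by blast
qed

end

section \<open>The closed support, the annihilator and the action of the quotient\<close>

theorem proposition5p6:
  fixes K :: "('k, 'z) ring_scheme"
    and G :: "'a groupoid"
    and E :: "('a, 'k, 'e) gsheaf"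
    and X :: "'a set"
  assumes "field K"
    and "ample_groupoid G"
    and "simple_gsheaf K G E"
    and "X = unit_space G closure_of sheaf_support G E"
  shows "closedin (unit_space G) X \<and> invariant G X \<and>
    (\<forall>u \<in> sheaf_support G E. unit_space G closure_of orbit G u = X) \<and>
    carrier (steinberg_algebra K (restrict_groupoid G (unit_set G - X)))
      \<subseteq> annihilator (steinberg_algebra K G) (compact_sections K G E) \<and>
    (\<exists>act. simple_module (steinberg_algebra K (restrict_groupoid G X))
             ((compact_sections K G E)\<lparr>smult := act\<rparr>) \<and>
           (\<forall>f \<in> carrier (steinberg_algebra K G). \<forall>t \<in> carrier (compact_sections K G E).
             f \<odot>\<^bsub>compact_sections K G E\<^esub> t = act (steinberg_quotient K G X f) t))"
proof (intro conjI ballI subsetI)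
  interpret K: field K by fact
  interpret ample_groupoid G by fact
  interpret gsheaf_vector_spaces K G E using assms(3) by (simp add: simple_gsheaf_def)
  interpret ample_gsheaf K G E ..
  have simple: "simple_module (steinberg_algebra K G) \<Gamma>" using assms(3) by (simp add: simple_gsheaf_def)
  let ?S = "sheaf_support G E"
  have S: "?S \<subseteq> unit_set G" by (auto simp: sheaf_support_def)
  show closed: "closedin (unit_space G) X" by (simp add: assms(4))
  have X: "X \<subseteq> unit_set G" using closedin_subset[OF closed] by (simp add: topspace_unit_space)
  have SX: "?S \<subseteq> X" using S by (simp add: assms(4) closure_of_subset topspace_unit_space)
  have inv: "rng G \<gamma> \<in> X" if "\<gamma> \<in> arrows G" "src G \<gamma> \<in> X" for \<gamma>
    using rng_in_closure[OF S rng_in_support] that by (simp add: assms(4))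
  show "invariant G X" by (rule invariantI[OF X inv])
  show "unit_space G closure_of orbit G u = X" if "u \<in> ?S" for u
    using closure_of_orbit[OF simple that] assms(4) by simp
  have off_X: "t u = zero_section E u" if "t \<in> carrier \<Gamma>" "u \<in> unit_set G" "u \<notin> X" for t u
    using stalk_eq_zero section_stalk that SX by blast
  show "f \<in> annihilator (steinberg_algebra K G) \<Gamma>"
    if f: "f \<in> carrier (steinberg_algebra K (restrict_groupoid G (unit_set G - X)))" for f
  proof -
    have "openin (unit_space G) (unit_set G - X)"
      using openin_diff[OF openin_topspace closed] by (simp add: topspace_unit_space)
    then have fG: "f \<in> carrier (steinberg_algebra K G)"
      using K.steinberg_algebra_restrict_open topological_groupoid_axioms f by blast
    have "f \<odot>\<^bsub>\<Gamma>\<^esub> t = \<zero>\<^bsub>\<Gamma>\<^esub>" if t: "t \<in> carrier \<Gamma>" for t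
    proof
      fix v
      show "(f \<odot>\<^bsub>\<Gamma>\<^esub> t) v = \<zero>\<^bsub>\<Gamma>\<^esub> v"
      proof (cases "v \<in> unit_set G")
        case True
        have "(f \<odot>\<^bsub>\<Gamma>\<^esub> t) v = zero_section E v"
        proof (rule section_smult_zero[OF True K.steinberg_algebra_values[OF fG]])
          \<comment> \<open>The function \<open>f\<close> lives on arrows with source outside
            \<open>X\<close>, exactly where every section is zero.\<close>
          fix \<gamma> assume "\<gamma> \<in> arrows G" "f \<gamma> \<noteq> \<zero>\<^bsub>K\<^esub>"
          then have "src G \<gamma> \<in> unit_set G - X"
            using K.steinberg_algebra_eq_zero[OF f, of \<gamma>] by (auto simp: arrows_restrict_groupoid)
          then show "t (src G \<gamma>) = zero_section E (src G \<gamma>)" using off_X[OF t] by blast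
        qed
        then show ?thesis using section_zero_eq[OF True] by simp
      qed (simp add: compact_sections_def)
    qed
    then show ?thesis using fG by (simp add: annihilator_def)
  qed
  let ?q = "steinberg_quotient K G X"
  have q: "?q f \<odot>\<^bsub>\<Gamma>\<^esub> t = f \<odot>\<^bsub>\<Gamma>\<^esub> t" if "f \<in> carrier (steinberg_algebra K G)" "t \<in> carrier \<Gamma>" for f t
    using that section_smult_quotient off_X by blast
  \<comment> \<open>The original \<open>smult\<close> is the witness for \<open>act\<close>:
    functions on \<open>G\<close> restricted to \<open>X\<close> are encoded on the same type, and
    by \<open>q\<close> they act as the functions they come from.\<close>
  have "simple_module (steinberg_algebra K (restrict_groupoid G X)) (\<Gamma>\<lparr>smult := smult \<Gamma>\<rparr>)"
  proof (rule simple_module_hom_image[OF simple, where h = ?q])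
    show "?q ` carrier (steinberg_algebra K G) = carrier (steinberg_algebra K (restrict_groupoid G X))"
      by (rule K.steinberg_quotient_image[OF assms(2) closed])
    show "?q \<zero>\<^bsub>steinberg_algebra K G\<^esub> = \<zero>\<^bsub>steinberg_algebra K (restrict_groupoid G X)\<^esub>"
      by (simp add: steinberg_algebra_def K.steinberg_quotient_zero)
    show "?q (f \<oplus>\<^bsub>steinberg_algebra K G\<^esub> g) =
        ?q f \<oplus>\<^bsub>steinberg_algebra K (restrict_groupoid G X)\<^esub> ?q g" for f g
      by (simp add: steinberg_algebra_def K.steinberg_quotient_add)
    show "?q (f \<otimes>\<^bsub>steinberg_algebra K G\<^esub> g) =
        ?q f \<otimes>\<^bsub>steinberg_algebra K (restrict_groupoid G X)\<^esub> ?q g"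
      if "f \<in> carrier (steinberg_algebra K G)" "g \<in> carrier (steinberg_algebra K G)" for f g
      using K.steinberg_quotient_mult[OF topological_groupoid_axioms inv that] .
  qed (rule q)
  then show "\<exists>act. simple_module (steinberg_algebra K (restrict_groupoid G X)) (\<Gamma>\<lparr>smult := act\<rparr>) \<and>
      (\<forall>f \<in> carrier (steinberg_algebra K G). \<forall>t \<in> carrier \<Gamma>. f \<odot>\<^bsub>\<Gamma>\<^esub> t = act (?q f) t)"
    using q by (intro exI[of _ "smult \<Gamma>"]) simp
qed

end
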